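(* Let $\phi=\frac{1+\sqrt5}2$. Consider scheduling with uncertain processing times on $m$ machines with the objective of minimizing the total completion time. By choosing $\alpha=\phi$ and $\beta=\frac{\phi+\sqrt{5\phi+1}}{2}\le 2.31652$, the competitive ratio of the algorithm $(\alpha,\beta)$-PCPM on $m$ machines is $$\sqrt5\left(\frac12+\frac1{2m}\right)+\phi\left(1-\frac1m\right)$$ for instances with uniform testing times (all $t_j$ equal, without loss of generality $t_j=1$). When $m$ tends to infinity, the competitive ratio is $2.73606$.
   Context: Problem. There are $n$ jobs, all available at time $0$, and $m$ identical machines, each of which runs one task at a time. Job $j$ has a testing time $t_j$, an upper limit $u_j$, and a real processing time $p_j\in[0,u_j]$. A job may be executed untested, which takes $u_j$ time units, or it may be tested (taking $t_j$ time units) and afterwards, once the test is finished, executed in $p_j$ time units; other tasks may run between the test and the execution, and the test and the execution of a job may be on different machines. The completion time of a job is the time at which its execution (or execution-untested) ends, and the cost of a schedule is the sum of the completion times of all jobs. An online algorithm knows all $t_j,u_j$ from the start, but learns $p_j$ only when the test of $j$ is finished. $\mathrm{OPT}$ knows all $p_j$ in advance (but must still test $j$ in order to run it in time $p_j$), and its cost is the minimum cost of any schedule. An online algorithm $A$ has competitive ratio $c$ if $\mathrm{cost}(A)\le c\cdot\mathrm{cost}(\mathrm{OPT})$ on all instances considered (so the stated ratio is an upper-bound guarantee). Algorithm $(\alpha,\beta)$-PCPM. Maintain a priority queue of tasks, smaller weight meaning higher priority. Initially, for each job $j$: if $u_j\ge\alpha t_j$, insert a testing task of weight $\beta t_j$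 (job $j$ will be tested); otherwise insert an execution-untested task of weight $u_j$. Whenever a machine becomes idle: if the task it has just finished was the testing task of a job $i$, insert the execution task of $i$ (running time $p_i$) with weight $t_i+p_i$ into the queue; then extract a task of smallest weight from the queue and run it on that machine. *)

theory Defs
  imports Complex_Main
begin

text \<open>
  Jobs are numbered \<open>0, \<dots>, jobs I - 1\<close> and the \<open>m\<close> machines \<open>0, \<dots>, m - 1\<close>; the values of the
  functions below at other arguments are irrelevant.
\<close>

record job_instance =
  jobs :: nat
  t_time :: "nat \<Rightarrow> real"
  u_time :: "nat \<Rightarrow> real"
  p_time :: "nat \<Rightarrow> real"

definition valid_instance :: "job_instance \<Rightarrow> bool" where
  "valid_instance I \<longleftrightarrow>
     (\<forall>j<jobs I. 0 \<le> t_time I j \<and> 0 \<le> p_time I j \<and> p_time I j \<le> u_time I j)"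

definition uniform_instances :: "job_instance set" where
  "uniform_instances = {I. valid_instance I \<and> (\<exists>\<tau>>0. \<forall>j<jobs I. t_time I j = \<tau>)}"

datatype task = Test nat | Exec nat | Untested nat

fun job_of :: "task \<Rightarrow> nat" where
  "job_of (Test j) = j"
| "job_of (Exec j) = j"
| "job_of (Untested j) = j"

fun duration :: "job_instance \<Rightarrow> task \<Rightarrow> real" where
  "duration I (Test j) = t_time I j"
| "duration I (Exec j) = p_time I j"
| "duration I (Untested j) = u_time I j"

text \<open>
  A schedule maps each task that is run to its machine and its starting time. Tasks are not
  preempted; \<open>feasible\<close> is the offline notion, in which \<open>p_time\<close> is known.
\<close>

type_synonym schedule = "task \<rightharpoonup> nat \<times> real"

definition machine :: "schedule \<Rightarrow> task \<Rightarrow> nat" where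
  "machine S x = fst (the (S x))"

definition start :: "schedule \<Rightarrow> task \<Rightarrow> real" where
  "start S x = snd (the (S x))"

definition finish :: "job_instance \<Rightarrow> schedule \<Rightarrow> task \<Rightarrow> real" where
  "finish I S x = start S x + duration I x"

definition feasible :: "nat \<Rightarrow> job_instance \<Rightarrow> schedule \<Rightarrow> bool" where
  "feasible m I S \<longleftrightarrow>
     (\<forall>x\<in>dom S. job_of x < jobs I \<and> machine S x < m \<and> 0 \<le> start S x) \<and>
     (\<forall>j<jobs I.
        (Untested j \<in> dom S \<and> Test j \<notin> dom S \<and> Exec j \<notin> dom S) \<or>
        (Untested j \<notin> dom S \<and> Test j \<in> dom S \<and> Exec j \<in> dom S \<and>
         finish I S (Test j) \<le> start S (Exec j))) \<and>
     (\<forall>x\<in>dom S. \<forall>y\<in>dom S. x \<noteq> y \<and> machine S x = machine S y \<longrightarrow>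
        finish I S x \<le> start S y \<or> finish I S y \<le> start S x)"

definition completion_time :: "job_instance \<Rightarrow> schedule \<Rightarrow> nat \<Rightarrow> real" where
  "completion_time I S j =
     (if Untested j \<in> dom S then finish I S (Untested j) else finish I S (Exec j))"

definition cost :: "job_instance \<Rightarrow> schedule \<Rightarrow> real" where
  "cost I S = (\<Sum>j<jobs I. completion_time I S j)"

definition opt_cost :: "nat \<Rightarrow> job_instance \<Rightarrow> real" where
  "opt_cost m I = (INF S\<in>{S. feasible m I S}. cost I S)"

text \<open>
  The priority queue is a set of tasks, as no task is inserted twice. \<open>last_task s i\<close> is the task
  most recently started on machine \<open>i\<close>, which ends at time \<open>free_at s i\<close>; \<open>active s\<close> contains the
  machines for which this end has not been processed yet.
\<close>

record pcpm_state =
  queue :: "task set"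
  active :: "nat set"
  last_task :: "nat \<Rightarrow> task option"
  free_at :: "nat \<Rightarrow> real"
  plan :: schedule

fun weight :: "real \<Rightarrow> job_instance \<Rightarrow> task \<Rightarrow> real" where
  "weight \<beta> I (Test j) = \<beta> * t_time I j"
| "weight \<beta> I (Exec j) = t_time I j + p_time I j"
| "weight \<beta> I (Untested j) = u_time I j"

fun released :: "task option \<Rightarrow> task set" where
  "released (Some (Test j)) = {Exec j}"
| "released _ = {}"

definition pcpm_init :: "nat \<Rightarrow> real \<Rightarrow> job_instance \<Rightarrow> pcpm_state" where
  "pcpm_init m \<alpha> I =
     \<lparr>queue = (\<lambda>j. if u_time I j \<ge> \<alpha> * t_time I j then Test j else Untested j) ` {..<jobs I},
      active = {..<m}, last_task = (\<lambda>_. None), free_at = (\<lambda>_. 0), plan = Map.empty\<rparr>"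

text \<open>
  One step processes the moment at which machine \<open>i\<close> becomes idle. Ties (between simultaneous events
  and between equal weights) may be broken arbitrarily, hence a relation. A machine that finds the
  queue empty can be dropped for good: from then on each step inserts at most one task, which is
  extracted again in the same step.
\<close>

inductive pcpm_step :: "real \<Rightarrow> job_instance \<Rightarrow> pcpm_state \<Rightarrow> pcpm_state \<Rightarrow> bool"
  for \<beta> :: real and I :: job_instance where
  run_task:
    "\<lbrakk>i \<in> active s; \<forall>k\<in>active s. free_at s i \<le> free_at s k;
      Q = queue s \<union> released (last_task s i);
      x \<in> Q; \<forall>y\<in>Q. weight \<beta> I x \<le> weight \<beta> I y\<rbrakk>
     \<Longrightarrow> pcpm_step \<beta> I s
          (s\<lparr>queue := Q - {x},
             last_task := (last_task s)(i := Some x),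
             free_at := (free_at s)(i := free_at s i + duration I x),
             plan := (plan s)(x \<mapsto> (i, free_at s i))\<rparr>)"
| stay_idle:
    "\<lbrakk>i \<in> active s; \<forall>k\<in>active s. free_at s i \<le> free_at s k;
      queue s \<union> released (last_task s i) = {}\<rbrakk>
     \<Longrightarrow> pcpm_step \<beta> I s (s\<lparr>active := active s - {i}\<rparr>)"

definition pcpm :: "real \<Rightarrow> real \<Rightarrow> nat \<Rightarrow> job_instance \<Rightarrow> schedule \<Rightarrow> bool" where
  "pcpm \<alpha> \<beta> m I S \<longleftrightarrow>
     (\<exists>s. (pcpm_step \<beta> I)\<^sup>*\<^sup>* (pcpm_init m \<alpha> I) s \<and> active s = {} \<and> plan s = S)"

text \<open>
  \<open>A m I S\<close> means that the (nondeterministic) algorithm \<open>A\<close>, run on \<open>m\<close> machines on instance \<open>I\<close>,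
  may produce schedule \<open>S\<close>. The ratio is an upper bound guarantee.
\<close>

definition has_competitive_ratio ::
  "(nat \<Rightarrow> job_instance \<Rightarrow> schedule \<Rightarrow> bool) \<Rightarrow> nat \<Rightarrow> job_instance set \<Rightarrow> real \<Rightarrow> bool" where
  "has_competitive_ratio A m \<I> c \<longleftrightarrow>
     (\<forall>I\<in>\<I>. (\<exists>S. A m I S) \<and> (\<forall>S. A m I S \<longrightarrow> feasible m I S \<and> cost I S \<le> c * opt_cost m I))"

end

theory Submission
  imports Defs "HOL-Analysis.Convex"
begin

text \<open>
  Let \<open>\<rho>\<^sub>j = min u\<^sub>j (t\<^sub>j + p\<^sub>j)\<close>, \<open>R = \<Sum>\<^sub>j \<rho>\<^sub>j\<close> and let \<open>K\<close> be the sum of \<open>min \<rho>\<^sub>j \<rho>\<^sub>k\<close> over all ordered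
  pairs, including \<open>j = k\<close>. Comparing completion times with mean busy times, a feasible schedule
  costs at least \<open>R / 2 + K / (2 m)\<close>, the bound of Eastman, Even and Isaacs, and clearly at least \<open>R\<close>.

  In a run of the algorithm all machines are busy as long as the queue is nonempty, and the queue
  never contains a task lighter than one already started. Hence a job completes at the latest after
  its own running time (at most \<open>\<phi> \<rho>\<^sub>j\<close>) plus \<open>1 / m\<close> of the work of other jobs that precedes, and
  has no larger weight than, the last task of the job taken from the queue. For uniform testing
  times this preceding work together with the running times adds up to at most
  \<open>sqrt 5 * (K + R) / 2\<close>; the extremal pair consists of two tested jobs with \<open>u = p = \<phi>\<close>, where
  \<open>(2 + \<phi>) / \<phi> = sqrt 5\<close>. So the cost is at most
  \<open>sqrt 5 * (K + R) / (2 m) + (1 - 1 / m) \<phi> R\<close>, and the ratio follows from the two lower bounds.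
\<close>

section \<open>A lower bound for feasible schedules\<close>

text \<open>\<open>min (P x) (P y)\<close> is the integral over all thresholds below both values,
  and for a single threshold the claim is the Cauchy-Schwarz inequality for the \<open>m\<close>
  block totals. The induction peels off the lowest threshold: after subtracting the least value of
  \<open>P\<close>, an element attaining it no longer contributes.\<close>

lemma min_kernel_le_blocks:
  fixes w P :: "'a \<Rightarrow> real" and f :: "'a \<Rightarrow> nat"
  assumes "finite X" "\<And>x. x \<in> X \<Longrightarrow> f x < m" "\<And>x. x \<in> X \<Longrightarrow> 0 \<le> P x"
  shows "(\<Sum>x\<in>X. \<Sum>y\<in>X. w x * w y * min (P x) (P y))
    \<le> real m * (\<Sum>x\<in>X. \<Sum>y\<in>X. if f x = f y then w x * w y * min (P x) (P y) else 0)"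
  using assms
proof (induction "card X" arbitrary: X P)
  case 0
  then show ?case by simp
next
  case (Suc n)
  define q where "q = Min (P ` X)"
  have ne: "X \<noteq> {}" using Suc by auto
  then have "q \<in> P ` X" unfolding q_def using Suc by simp
  then obtain x0 where x0: "x0 \<in> X" "P x0 = q" by auto
  have qle: "q \<le> P x" if "x \<in> X" for x unfolding q_def using Suc that by simp
  have q0: "0 \<le> q" using x0 Suc by auto
  define P' where "P' x = P x - q" for x
  define X' where "X' = X - {x0}"
  have X: "X = insert x0 X'" "x0 \<notin> X'" "finite X'" using x0 Suc by (auto simp: X'_def)
  have P'0: "P' x0 = 0" "\<And>x. x \<in> X \<Longrightarrow> 0 \<le> P' x" using x0 qle by (auto simp: P'_def)
  have mn: "min (P x) (P y) = q + min (P' x) (P' y)" for x y by (auto simp: P'_def)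
  \<comment> \<open>The coefficient \<open>g\<close> is arbitrary because this serves both the full
    sum and the sum restricted to pairs in one block.\<close>
  have drop1: "(\<Sum>x\<in>X. \<Sum>y\<in>X. g x y * min (P' x) (P' y))
      = (\<Sum>x\<in>X'. \<Sum>y\<in>X'. g x y * min (P' x) (P' y))" for g
  proof -
    have "min (P' x0) (P' y) = 0" "min (P' y) (P' x0) = 0" if "y \<in> X'" for y
      using P'0(1) P'0(2)[of y] that X by (simp_all add: min_def)
    then have "(\<Sum>y\<in>X'. g x0 y * min (P' x0) (P' y)) = 0" "(\<Sum>x\<in>X'. g x x0 * min (P' x) (P' x0)) = 0"
      by (auto intro: sum.neutral)
    then show ?thesis using X P'0(1) by (simp add: sum.distrib)
  qed
  define b where "b x y = (if f x = f y then w x * w y else 0)" for x y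
  have IH: "(\<Sum>x\<in>X'. \<Sum>y\<in>X'. w x * w y * min (P' x) (P' y))
    \<le> real m * (\<Sum>x\<in>X'. \<Sum>y\<in>X'. if f x = f y then w x * w y * min (P' x) (P' y) else 0)"
  proof (rule Suc.hyps(1))
    show "n = card X'" using Suc.hyps(2) X by simp
  qed (use X Suc.prems P'0 in auto)
  have ifb: "(if f x = f y then w x * w y * c else 0) = b x y * c" for x y c
    by (simp add: b_def)
  define W where "W i = (\<Sum>x | x \<in> X \<and> f x = i. w x)" for i
  have fX: "f ` X \<subseteq> {..<m}" using Suc by auto
  have sW: "(\<Sum>x\<in>X. w x) = (\<Sum>i<m. W i)"
    unfolding W_def using sum.group[OF \<open>finite X\<close> _ fX, of w] by simp
  have "(\<Sum>x\<in>X. \<Sum>y\<in>X. b x y) = (\<Sum>x\<in>X. w x * W (f x))"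
    unfolding b_def W_def sum_distrib_left
    by (simp add: sum.inter_filter Suc.prems(1) eq_commute)
  also have "\<dots> = (\<Sum>i<m. \<Sum>x | x \<in> X \<and> f x = i. w x * W (f x))"
    using sum.group[OF \<open>finite X\<close> _ fX, of "\<lambda>x. w x * W (f x)"] by simp
  also have "\<dots> = (\<Sum>i<m. (W i)\<^sup>2)"
    by (intro sum.cong refl) (simp add: power2_eq_square W_def sum_distrib_right)
  finally have bW: "(\<Sum>x\<in>X. \<Sum>y\<in>X. b x y) = (\<Sum>i<m. (W i)\<^sup>2)" .
  have sq: "(\<Sum>i<m. W i)\<^sup>2 \<le> real m * (\<Sum>i<m. (W i)\<^sup>2)"
    using sum_squared_le_sum_of_squares[of W "{..<m}"] by (simp add: mult.commute)
  have "(\<Sum>x\<in>X. \<Sum>y\<in>X. w x * w y * min (P x) (P y))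
      = q * (\<Sum>x\<in>X. w x)\<^sup>2 + (\<Sum>x\<in>X'. \<Sum>y\<in>X'. w x * w y * min (P' x) (P' y))"
    unfolding mn drop1[symmetric] power2_eq_square sum_product
    by (simp add: algebra_simps sum.distrib sum_distrib_left)
  also have "\<dots> \<le> q * (real m * (\<Sum>x\<in>X. \<Sum>y\<in>X. b x y))
      + real m * (\<Sum>x\<in>X'. \<Sum>y\<in>X'. b x y * min (P' x) (P' y))"
    unfolding sW bW using IH
    by (intro add_mono mult_left_mono sq q0) (simp add: ifb)
  also have "\<dots> = real m * (\<Sum>x\<in>X. \<Sum>y\<in>X. b x y * min (P x) (P y))"
    unfolding mn drop1[symmetric]
    by (simp add: algebra_simps sum.distrib sum_distrib_left)
  finally show ?case by (simp add: ifb)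
qed

text \<open>Remove the interval with the latest start; all others end by that start, so induction
  applies with the start as the new bound. Intervals of length zero are discarded first, since one
  of them may share its start with an interval that ends later.\<close>

lemma sum_disjoint_intervals_le:
  fixes s d :: "'a \<Rightarrow> real"
  assumes "finite A" "0 \<le> e"
    and "\<And>x. x \<in> A \<Longrightarrow> 0 \<le> s x" "\<And>x. x \<in> A \<Longrightarrow> 0 \<le> d x" "\<And>x. x \<in> A \<Longrightarrow> s x + d x \<le> e"
    and "\<And>x y. x \<in> A \<Longrightarrow> y \<in> A \<Longrightarrow> x \<noteq> y \<Longrightarrow> s x + d x \<le> s y \<or> s y + d y \<le> s x"
  shows "sum d A \<le> e"
proof -
  have pos: "sum d B \<le> e" if "finite B" "0 \<le> e" "B \<subseteq> A" "\<forall>x\<in>B. 0 < d x \<and> s x + d x \<le> e" for B e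
    using that
  proof (induction "card B" arbitrary: B e)
    case 0
    then show ?case by simp
  next
    case (Suc n)
    then have ne: "B \<noteq> {}" by auto
    with Suc.prems(1) have "Max (s ` B) \<in> s ` B" by simp
    then obtain x where x: "x \<in> B" "s x = Max (s ` B)" by auto
    have ge: "s y \<le> s x" if "y \<in> B" for y using that x(2) Suc.prems(1) by simp
    have xA: "x \<in> A" using x(1) Suc.prems(3) by auto
    have "sum d (B - {x}) \<le> s x"
    proof (rule Suc.hyps(1))
      show "\<forall>y\<in>B - {x}. 0 < d y \<and> s y + d y \<le> s x"
      proof
        fix y assume y: "y \<in> B - {x}"
        then have yA: "y \<in> A" "x \<noteq> y" using Suc.prems(3) by auto
        have "s x + d x \<le> s y \<or> s y + d y \<le> s x" by (rule assms(6)[OF xA yA])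
        moreover have "0 < d y" "0 < d x" using y x(1) Suc.prems(4) by auto
        moreover have "s y \<le> s x" using ge y by simp
        ultimately show "0 < d y \<and> s y + d y \<le> s x" by linarith
      qed
      show "n = card (B - {x})" using Suc.hyps(2) Suc.prems(1) x(1) by simp
    qed (use Suc.prems(1,3) assms(3)[OF xA] in auto)
    moreover have "sum d B = d x + sum d (B - {x})" using x(1) Suc.prems(1) by (rule sum.remove[rotated])
    moreover have "s x + d x \<le> e" using x(1) Suc.prems(4) by simp
    ultimately show ?case by simp
  qed
  have "sum d A = sum d {x\<in>A. 0 < d x}"
    by (rule sum.mono_neutral_right) (use assms(1) assms(4) in \<open>force+\<close>)
  also have "\<dots> \<le> e"
    by (rule pos) (use assms(1,2) assms(5) in \<open>simp_all add: subset_iff\<close>)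
  finally show ?thesis .
qed

text \<open>
  Smith's rule on each machine: \<open>w x\<close> is the share of its job that task \<open>x\<close> does and \<open>P x\<close> is the total
  work of that job, so every job has weight \<open>1\<close> even if its two tasks are on different machines.
\<close>

lemma machine_sum_ge_min_kernel:
  fixes s d w P :: "'a \<Rightarrow> real" and f :: "'a \<Rightarrow> nat"
  assumes "finite X"
    and s: "\<And>x. x \<in> X \<Longrightarrow> 0 \<le> s x" and d: "\<And>x. x \<in> X \<Longrightarrow> 0 \<le> d x"
    and w: "\<And>x. x \<in> X \<Longrightarrow> 0 \<le> w x" and wP: "\<And>x. x \<in> X \<Longrightarrow> w x * P x = d x"
    and dis: "\<And>x y. x \<in> X \<Longrightarrow> y \<in> X \<Longrightarrow> x \<noteq> y \<Longrightarrow> f x = f y \<Longrightarrow>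
      s x + d x \<le> s y \<or> s y + d y \<le> s x"
  shows "(\<Sum>x\<in>X. \<Sum>y\<in>X. if f x = f y then w x * w y * min (P x) (P y) else 0)
    \<le> 2 * (\<Sum>x\<in>X. w x * (s x + d x / 2))"
proof -
  define bef where "bef x y \<longleftrightarrow> x \<noteq> y \<and> f x = f y \<and> s x + d x \<le> s y" for x y
  \<comment> \<open>\<open>T x y\<close> is the weighted wait that \<open>x\<close> causes to a
    later \<open>y\<close> on the same machine.\<close>
  define T where "T x y = (if bef x y then w y * d x else 0)" for x y
  have le_s: "(\<Sum>x\<in>X. T x y) \<le> w y * s y" if "y \<in> X" for y
  proof -
    have "(\<Sum>x\<in>X. T x y) = w y * sum d {x\<in>X. bef x y}"
      unfolding T_def sum_distrib_left using assms(1) by (subst sum.inter_filter[symmetric]) auto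
    also have "sum d {x\<in>X. bef x y} \<le> s y"
    proof (rule sum_disjoint_intervals_le[where s = s])
      fix x z assume "x \<in> {x\<in>X. bef x y}" "z \<in> {x\<in>X. bef x y}" "x \<noteq> z"
      then show "s x + d x \<le> s z \<or> s z + d z \<le> s x" using dis[of x z] by (auto simp: bef_def)
    qed (use that assms(1) s d in \<open>auto simp: bef_def\<close>)
    finally show ?thesis using w that by (simp add: mult_left_mono)
  qed
  \<comment> \<open>Whichever of the two runs first, the wait is
    \<open>w y * d x = w x * w y * P x\<close> or the symmetric expression, and both dominate the
    kernel. The diagonal is paid by the half durations in the busy times.\<close>
  have pair: "(if f x = f y then w x * w y * min (P x) (P y) else 0)
      \<le> T x y + T y x + (if x = y then w x * d x else 0)" if "x \<in> X" "y \<in> X" for x y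
  proof -
    have T0: "0 \<le> T x y" "0 \<le> T y x" using that w d by (auto simp: T_def)
    show ?thesis
    proof (cases "f x = f y \<and> x \<noteq> y")
      case True
      have "w x * w y * min (P x) (P y) \<le> w x * w y * P x" "w x * w y * min (P x) (P y) \<le> w x * w y * P y"
        using w that by (intro mult_left_mono; simp)+
      then have "w x * w y * min (P x) (P y) \<le> w y * d x" "w x * w y * min (P x) (P y) \<le> w x * d y"
        unfolding wP[OF that(1), symmetric] wP[OF that(2), symmetric]
        by (simp_all add: mult.commute mult.left_commute)
      moreover have "bef x y \<or> bef y x" using dis[OF that] True by (auto simp: bef_def)
      ultimately show ?thesis using True T0 by (auto simp: T_def)
    next
      case False
      then show ?thesis using T0 wP[OF that(1)] by (auto simp: mult.assoc)
    qed
  qed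
  have "(\<Sum>x\<in>X. \<Sum>y\<in>X. if f x = f y then w x * w y * min (P x) (P y) else 0)
      \<le> (\<Sum>x\<in>X. \<Sum>y\<in>X. T x y + T y x + (if x = y then w x * d x else 0))"
    by (intro sum_mono pair)
  also have "\<dots> = (\<Sum>x\<in>X. \<Sum>y\<in>X. T x y) + (\<Sum>x\<in>X. \<Sum>y\<in>X. T y x) + (\<Sum>x\<in>X. w x * d x)"
    using assms(1) by (simp add: sum.distrib)
  also have "(\<Sum>x\<in>X. \<Sum>y\<in>X. T x y) = (\<Sum>x\<in>X. \<Sum>y\<in>X. T y x)" by (rule sum.swap)
  also have "(\<Sum>x\<in>X. \<Sum>y\<in>X. T y x) \<le> (\<Sum>x\<in>X. w x * s x)" by (intro sum_mono le_s)
  finally show ?thesis by (simp add: algebra_simps sum.distrib sum_distrib_left)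
qed

section \<open>Processing volumes of jobs and the two lower bounds on the cost\<close>

definition min_time :: "job_instance \<Rightarrow> nat \<Rightarrow> real" where
  "min_time I j = min (u_time I j) (t_time I j + p_time I j)"

definition run_time :: "job_instance \<Rightarrow> schedule \<Rightarrow> nat \<Rightarrow> real" where
  "run_time I S j = (if Untested j \<in> dom S then u_time I j else t_time I j + p_time I j)"

lemma valid_instanceD:
  assumes "valid_instance I" "j < jobs I"
  shows "0 \<le> t_time I j" "0 \<le> p_time I j" "p_time I j \<le> u_time I j" "0 \<le> u_time I j"
  using assms unfolding valid_instance_def by (auto intro: order_trans)

lemma duration_nonneg:
  assumes "valid_instance I" "job_of x < jobs I"
  shows "0 \<le> duration I x"
  using valid_instanceD[OF assms] by (cases x) auto

lemma min_time_le_run_time: "min_time I j \<le> run_time I S j"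
  by (simp add: min_time_def run_time_def)

lemma feasible_finite_dom:
  assumes "feasible m I S"
  shows "finite (dom S)"
proof (rule finite_subset)
  show "dom S \<subseteq> Test ` {..<jobs I} \<union> Exec ` {..<jobs I} \<union> Untested ` {..<jobs I}"
  proof
    fix x assume "x \<in> dom S"
    then have "job_of x < jobs I" using assms by (auto simp: feasible_def)
    then show "x \<in> Test ` {..<jobs I} \<union> Exec ` {..<jobs I} \<union> Untested ` {..<jobs I}"
      by (cases x) auto
  qed
qed simp

text \<open>The three possible tasks are listed explicitly so that the sum splits into one
  conditional term per task.\<close>

definition work_in :: "job_instance \<Rightarrow> nat \<Rightarrow> task set \<Rightarrow> real" where
  "work_in I k A = (\<Sum>x\<in>A \<inter> {Test k, Exec k, Untested k}. duration I x)"

lemma sum_group_by_job: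
  fixes g :: "task \<Rightarrow> real"
  assumes "finite A" "\<And>x. x \<in> A \<Longrightarrow> job_of x < n"
  shows "(\<Sum>x\<in>A. g x) = (\<Sum>k<n. \<Sum>x\<in>A \<inter> {Test k, Exec k, Untested k}. g x)"
proof -
  have im: "job_of ` A \<subseteq> {..<n}" using assms(2) by auto
  have "job_of x = k \<longleftrightarrow> x \<in> {Test k, Exec k, Untested k}" for x k by (cases x) auto
  then have "{x \<in> A. job_of x = k} = A \<inter> {Test k, Exec k, Untested k}" for k by blast
  then show ?thesis using sum.group[OF assms(1) finite_lessThan im, of g] by simp
qed

lemma sum_tasks_by_job:
  fixes g :: "task \<Rightarrow> real"
  assumes "feasible m I S"
  shows "(\<Sum>x\<in>dom S. g x) =
    (\<Sum>j<jobs I. if Untested j \<in> dom S then g (Untested j) else g (Test j) + g (Exec j))"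
proof -
  have "(\<Sum>x\<in>dom S. g x) = (\<Sum>j<jobs I. \<Sum>x\<in>dom S \<inter> {Test j, Exec j, Untested j}. g x)"
    by (rule sum_group_by_job[OF feasible_finite_dom[OF assms]]) (use assms in \<open>auto simp: feasible_def\<close>)
  also have "\<dots> = (\<Sum>j<jobs I. if Untested j \<in> dom S then g (Untested j) else g (Test j) + g (Exec j))"
  proof (intro sum.cong refl)
    fix j assume "j \<in> {..<jobs I}"
    then have "dom S \<inter> {Test j, Exec j, Untested j}
        = (if Untested j \<in> dom S then {Untested j} else {Test j, Exec j})"
      using assms unfolding feasible_def by auto
    then show "(\<Sum>x\<in>dom S \<inter> {Test j, Exec j, Untested j}. g x)
        = (if Untested j \<in> dom S then g (Untested j) else g (Test j) + g (Exec j))" by simp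
  qed
  finally show ?thesis .
qed

lemma feasible_completion_time:
  assumes "feasible m I S" "valid_instance I" "j < jobs I"
  shows "run_time I S j \<le> completion_time I S j"
proof (cases "Untested j \<in> dom S")
  case True
  then have "0 \<le> start S (Untested j)" using assms by (auto simp: feasible_def)
  then show ?thesis using True by (simp add: run_time_def completion_time_def finish_def)
next
  case False
  then have "Test j \<in> dom S" "finish I S (Test j) \<le> start S (Exec j)"
    using assms by (auto simp: feasible_def)
  moreover from this(1) have "0 \<le> start S (Test j)"
    using assms by (auto simp: feasible_def)
  ultimately show ?thesis using False by (simp add: run_time_def completion_time_def finish_def)
qed

lemma sum_min_time_le_cost:
  assumes "feasible m I S" "valid_instance I"
  shows "(\<Sum>j<jobs I. min_time I j) \<le> cost I S"
  unfolding cost_def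
  by (intro sum_mono order_trans[OF min_time_le_run_time[of I _ S]] feasible_completion_time[OF assms]) simp

text \<open>Each job of positive run time spreads weight one over its tasks in proportion to their
  durations. Its weighted mean busy time is then at most its completion time minus half its run
  time, while the two preceding kernel inequalities bound the sum of these means from below.\<close>

lemma min_kernel_le_cost:
  assumes S: "feasible m I S" and valid: "valid_instance I" and "1 \<le> m"
  shows "(\<Sum>j<jobs I. min_time I j) / 2
    + (\<Sum>j<jobs I. \<Sum>k<jobs I. min (min_time I j) (min_time I k)) / (2 * real m) \<le> cost I S"
proof -
  define n where "n = jobs I"
  define P where "P = run_time I S"
  define w where "w x = duration I x / P (job_of x)" for x
  note v = valid_instanceD[OF valid, folded n_def]
  have job: "job_of x < n" "0 \<le> duration I x" "0 \<le> start S x" "machine S x < m" if "x \<in> dom S" for x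
    using that S duration_nonneg[OF valid, of x] unfolding feasible_def n_def by auto
  have Pn: "0 \<le> P j" if "j < n" for j
    using v[OF that] by (simp add: P_def run_time_def)
  have wP: "w x * P (job_of x) = duration I x" if "x \<in> dom S" for x
  proof (cases "P (job_of x) = 0")
    case True
    have "duration I x \<le> P (job_of x)"
      using that S v[OF job(1)[OF that]] job(1)[OF that]
      unfolding P_def run_time_def feasible_def n_def by (cases x) auto
    then show ?thesis using True job(2)[OF that] by simp
  qed (simp add: w_def)
  have w1: "P j = 0 \<or>
      (if Untested j \<in> dom S then w (Untested j) else w (Test j) + w (Exec j)) = 1" for j
    by (auto simp: w_def P_def run_time_def add_divide_distrib[symmetric])
  \<comment> \<open>If \<open>P j = 0\<close>, division by zero makes the weights of
    \<open>j\<close> vanish instead of adding up to one, so \<open>h\<close> must vanish there as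
    well.\<close>
  have split: "(\<Sum>x\<in>dom S. w x * h (job_of x)) = (\<Sum>j<n. h j)"
    if "\<And>j. j < n \<Longrightarrow> P j = 0 \<Longrightarrow> h j = 0" for h
    unfolding sum_tasks_by_job[OF S] n_def[symmetric]
  proof (intro sum.cong refl)
    fix j assume "j \<in> {..<n}"
    then have "P j = 0 \<Longrightarrow> h j = 0" using that by simp
    then show "(if Untested j \<in> dom S then w (Untested j) * h (job_of (Untested j))
        else w (Test j) * h (job_of (Test j)) + w (Exec j) * h (job_of (Exec j))) = h j"
      using w1[of j] by (cases "h j = 0") (auto simp: distrib_right[symmetric] split: if_splits)
  qed
  have min0: "min (P j) (P k) = 0" if "j < n" "k < n" "P j = 0 \<or> P k = 0" for j k
    using that Pn[of j] Pn[of k] by auto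
  have "(\<Sum>j<n. \<Sum>k<n. min (min_time I j) (min_time I k)) \<le> (\<Sum>j<n. \<Sum>k<n. min (P j) (P k))"
    unfolding P_def by (intro sum_mono min.mono min_time_le_run_time)
  also have "\<dots> = (\<Sum>x\<in>dom S. w x * (\<Sum>k<n. min (P (job_of x)) (P k)))"
    by (rule split[symmetric], rule sum.neutral) (use min0 in blast)
  also have "\<dots> = (\<Sum>x\<in>dom S. w x * (\<Sum>y\<in>dom S. w y * min (P (job_of x)) (P (job_of y))))"
    by (intro sum.cong refl arg_cong2[where f = "(*)"] split[symmetric]) (use job(1) min0 in blast)
  also have "\<dots> = (\<Sum>x\<in>dom S. \<Sum>y\<in>dom S. w x * w y * min (P (job_of x)) (P (job_of y)))"
    by (simp add: sum_distrib_left mult.assoc)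
  also have "\<dots> \<le> real m * (\<Sum>x\<in>dom S. \<Sum>y\<in>dom S. if machine S x = machine S y
      then w x * w y * min (P (job_of x)) (P (job_of y)) else 0)"
    by (rule min_kernel_le_blocks) (use feasible_finite_dom[OF S] job Pn in auto)
  also have "\<dots> \<le> real m * (2 * (\<Sum>x\<in>dom S. w x * (start S x + duration I x / 2)))"
  proof (intro mult_left_mono machine_sum_ge_min_kernel)
    fix x y assume "x \<in> dom S" "y \<in> dom S" "x \<noteq> y" "machine S x = machine S y"
    then show "start S x + duration I x \<le> start S y \<or> start S y + duration I y \<le> start S x"
      using S unfolding feasible_def finish_def by blast
  qed (use feasible_finite_dom[OF S] job wP Pn in \<open>auto simp: w_def\<close>)
  also have "\<dots> \<le> real m * (2 * (\<Sum>j<n. completion_time I S j - P j / 2))"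
    unfolding sum_tasks_by_job[OF S] n_def[symmetric]
  proof (intro mult_left_mono sum_mono)
    fix j assume "j \<in> {..<n}"
    then have j: "j < n" by simp
    show "(if Untested j \<in> dom S then w (Untested j) * (start S (Untested j) + duration I (Untested j) / 2)
        else w (Test j) * (start S (Test j) + duration I (Test j) / 2)
          + w (Exec j) * (start S (Exec j) + duration I (Exec j) / 2))
      \<le> completion_time I S j - P j / 2"
    proof (cases "P j = 0")
      case True
      then show ?thesis
        using feasible_completion_time[OF S valid, of j] j unfolding P_def[symmetric] n_def[symmetric]
        by (auto simp: w_def)
    next
      case False
      then have pos: "0 < P j" using Pn[OF j] by simp
      show ?thesis
      proof (cases "Untested j \<in> dom S")
        case True
        then show ?thesis using False
          by (simp add: w_def P_def run_time_def completion_time_def finish_def)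
      next
        case U: False
        define a b t p where "a = start S (Test j)" and "b = start S (Exec j)"
          and "t = t_time I j" and "p = p_time I j"
        have Pj: "P j = t + p" using U by (simp add: P_def run_time_def t_def p_def)
        have "finish I S (Test j) \<le> start S (Exec j)"
          using S j U unfolding feasible_def n_def by blast
        then have ab: "a + t \<le> b" by (simp add: finish_def a_def b_def t_def)
        \<comment> \<open>Moving the test to just before the execution can only raise the mean busy
          time. The job then fills an interval of length \<open>P j\<close> ending at its completion
          time, and the mean is the midpoint.\<close>
        have "t * (a + t / 2) + p * (b + p / 2) \<le> t * (b - t / 2) + p * (b + p / 2)"
          using ab v(1)[OF j] by (intro add_right_mono mult_left_mono) (auto simp: t_def)
        also have "\<dots> = (b + p - P j / 2) * P j"
          by (simp add: Pj field_simps)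
        finally have "(t * (a + t / 2) + p * (b + p / 2)) / P j \<le> b + p - P j / 2"
          using pos by (simp add: pos_divide_le_eq)
        then show ?thesis using U
          by (simp add: w_def completion_time_def finish_def a_def b_def t_def p_def add_divide_distrib)
      qed
    qed
  qed simp_all
  also have "\<dots> = real m * (2 * cost I S - (\<Sum>j<n. P j))"
    by (simp add: cost_def n_def sum_subtractf sum_divide_distrib[symmetric] algebra_simps)
  also have "\<dots> \<le> real m * (2 * cost I S - (\<Sum>j<n. min_time I j))"
    unfolding P_def by (intro mult_left_mono diff_left_mono sum_mono min_time_le_run_time) simp
  finally show ?thesis using \<open>1 \<le> m\<close> by (simp add: n_def field_simps)
qed

section \<open>Runs of the algorithm\<close>

definition tested :: "real \<Rightarrow> job_instance \<Rightarrow> nat \<Rightarrow> bool" where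
  "tested \<alpha> I j \<longleftrightarrow> \<alpha> * t_time I j \<le> u_time I j"

text \<open>While a test is the unprocessed last task of an active machine, its execution is in
  neither the queue nor the plan; the last two conjuncts track this gap. The second conjunct holds
  because machines are dropped only at an empty queue, which stays empty from then on.\<close>

definition task_inv :: "nat \<Rightarrow> real \<Rightarrow> job_instance \<Rightarrow> pcpm_state \<Rightarrow> bool" where
  "task_inv m \<alpha> I s \<longleftrightarrow>
    active s \<subseteq> {..<m} \<and> (queue s \<noteq> {} \<longrightarrow> active s = {..<m}) \<and>
    queue s \<inter> dom (plan s) = {} \<and>
    (\<forall>x\<in>queue s \<union> dom (plan s). job_of x < jobs I) \<and>
    (\<forall>j<jobs I. Untested j \<in> queue s \<union> dom (plan s) \<longleftrightarrow> \<not> tested \<alpha> I j) \<and>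
    (\<forall>j<jobs I. Test j \<in> queue s \<union> dom (plan s) \<longleftrightarrow> tested \<alpha> I j) \<and>
    (\<forall>j. Exec j \<in> queue s \<union> dom (plan s) \<longrightarrow> Test j \<in> dom (plan s)) \<and>
    (\<forall>j. Test j \<in> dom (plan s) \<longrightarrow> Exec j \<in> queue s \<union> dom (plan s) \<or>
      (\<exists>i\<in>active s. last_task s i = Some (Test j))) \<and>
    (\<forall>i\<in>active s. \<forall>j. last_task s i = Some (Test j) \<longrightarrow>
      Test j \<in> dom (plan s) \<and> Exec j \<notin> queue s \<union> dom (plan s) \<and> machine (plan s) (Test j) = i)"

text \<open>The final equation says that no machine idles before its \<open>free_at\<close>; the
  time of a dropped machine stays frozen, so the sum may range over all machines. The conjunct on
  queued executions guarantees that they cannot start before their tests end.\<close>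

definition time_inv :: "nat \<Rightarrow> job_instance \<Rightarrow> pcpm_state \<Rightarrow> bool" where
  "time_inv m I s \<longleftrightarrow>
    (\<forall>i. 0 \<le> free_at s i) \<and>
    (\<forall>x\<in>dom (plan s). machine (plan s) x < m \<and> 0 \<le> start (plan s) x \<and>
      finish I (plan s) x \<le> free_at s (machine (plan s) x)) \<and>
    (\<forall>x\<in>dom (plan s). \<forall>y\<in>dom (plan s). x \<noteq> y \<and> machine (plan s) x = machine (plan s) y \<longrightarrow>
      finish I (plan s) x \<le> start (plan s) y \<or> finish I (plan s) y \<le> start (plan s) x) \<and>
    (\<forall>i\<in>active s. \<forall>j. last_task s i = Some (Test j) \<longrightarrow> finish I (plan s) (Test j) = free_at s i) \<and>
    (\<forall>j. Exec j \<in> dom (plan s) \<longrightarrow> finish I (plan s) (Test j) \<le> start (plan s) (Exec j)) \<and>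
    (\<forall>j. Exec j \<in> queue s \<longrightarrow> (\<forall>k\<in>active s. finish I (plan s) (Test j) \<le> free_at s k)) \<and>
    (\<Sum>i<m. free_at s i) = (\<Sum>x\<in>dom (plan s). duration I x)"

text \<open>This keeps only two consequences of leaving the queue: all machines were busy with tasks
  of \<open>B x\<close> until the start, and none of these tasks is heavier. Thus the analysis can
  work with the finished schedule alone.\<close>

definition starts_from_queue ::
  "nat \<Rightarrow> real \<Rightarrow> job_instance \<Rightarrow> schedule \<Rightarrow> (task \<Rightarrow> task set) \<Rightarrow> task \<Rightarrow> bool" where
  "starts_from_queue m \<beta> I S B x \<longleftrightarrow>
    real m * start S x \<le> (\<Sum>y\<in>B x. duration I y) \<and> (\<forall>y\<in>B x. weight \<beta> I y \<le> weight \<beta> I x)"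

text \<open>
  \<open>B x\<close> is the set of tasks started before \<open>x\<close> in the order of the steps, which unlike the order of
  the starting times is strict.
\<close>

definition history :: "nat \<Rightarrow> real \<Rightarrow> job_instance \<Rightarrow> schedule \<Rightarrow> (task \<Rightarrow> task set) \<Rightarrow> bool" where
  "history m \<beta> I S B \<longleftrightarrow>
    (\<forall>x\<in>dom S. B x \<subseteq> dom S - {x} \<and> (\<forall>y\<in>B x. B y \<subseteq> B x)) \<and>
    (\<forall>x\<in>dom S. starts_from_queue m \<beta> I S B x \<or>
      (\<exists>j. x = Exec j \<and> start S (Exec j) = finish I S (Test j))) \<and>
    (\<forall>j. Exec j \<in> dom S \<longrightarrow> Test j \<in> B (Exec j))"

text \<open>
  A task enters the queue at the very step in which a machine takes a task of smallest weight, so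
  the queue never contains a task lighter than one that has already been started.
\<close>

definition queue_heavy :: "real \<Rightarrow> job_instance \<Rightarrow> pcpm_state \<Rightarrow> bool" where
  "queue_heavy \<beta> I s \<longleftrightarrow> (\<forall>x\<in>queue s. \<forall>y\<in>dom (plan s). weight \<beta> I y \<le> weight \<beta> I x)"

lemma plan_update [simp]:
  "machine (S(x \<mapsto> (i, a))) y = (if y = x then i else machine S y)"
  "start (S(x \<mapsto> (i, a))) y = (if y = x then a else start S y)"
  "finish I (S(x \<mapsto> (i, a))) y = (if y = x then a + duration I x else finish I S y)"
  by (simp_all add: machine_def start_def finish_def)

lemma released_cases:
  obtains (none) "released l = {}" "\<And>j. l \<noteq> Some (Test j)"
  | (exec) j where "l = Some (Test j)" "released l = {Exec j}"
proof (cases "\<exists>j. l = Some (Test j)")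
  case False
  then have "released l = {}" by (cases l rule: released.cases) auto
  then show ?thesis using none False by blast
qed (use exec in auto)

section \<open>Preservation of the invariants\<close>

lemma task_inv_init: "task_inv m \<alpha> I (pcpm_init m \<alpha> I)"
  unfolding task_inv_def pcpm_init_def tested_def by auto

lemma task_inv_step:
  assumes "pcpm_step \<beta> I s s'" "task_inv m \<alpha> I s"
  shows "task_inv m \<alpha> I s'"
  using assms(1)
proof cases
  case (run_task i Q x)
  note A = assms(2)[unfolded task_inv_def]
  have A1: "active s \<subseteq> {..<m}" "queue s \<noteq> {} \<Longrightarrow> active s = {..<m}"
    and A3: "queue s \<inter> dom (plan s) = {}"
    and A4: "\<forall>x\<in>queue s \<union> dom (plan s). job_of x < jobs I"
    and A5: "\<forall>j<jobs I. Untested j \<in> queue s \<union> dom (plan s) \<longleftrightarrow> \<not> tested \<alpha> I j"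
    and A6: "\<forall>j<jobs I. Test j \<in> queue s \<union> dom (plan s) \<longleftrightarrow> tested \<alpha> I j"
    and A7: "\<forall>j. Exec j \<in> queue s \<union> dom (plan s) \<longrightarrow> Test j \<in> dom (plan s)"
    and A8: "\<forall>j. Test j \<in> dom (plan s) \<longrightarrow> Exec j \<in> queue s \<union> dom (plan s) \<or>
      (\<exists>i\<in>active s. last_task s i = Some (Test j))"
    and A9: "\<forall>i\<in>active s. \<forall>j. last_task s i = Some (Test j) \<longrightarrow>
      Test j \<in> dom (plan s) \<and> Exec j \<notin> queue s \<union> dom (plan s) \<and> machine (plan s) (Test j) = i"
    using A by blast+
  let ?R = "released (last_task s i)"
  have R: "\<exists>j. z = Exec j \<and> last_task s i = Some (Test j)" if "z \<in> ?R" for z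
    using that by (cases "last_task s i" rule: released_cases) auto
  have R': "Exec j \<in> ?R" if "last_task s i = Some (Test j)" for j using that by simp
  have QD: "queue s' \<union> dom (plan s') = queue s \<union> dom (plan s) \<union> ?R"
    and D: "dom (plan s') = insert x (dom (plan s))"
    using run_task by auto
  have new: "x \<notin> dom (plan s)" using run_task A3 R A9 by blast
  show ?thesis unfolding task_inv_def QD
  proof (intro conjI allI impI ballI)
    show "active s' \<subseteq> {..<m}" using run_task A1 by simp
    show "active s' = {..<m}" if "queue s' \<noteq> {}"
    proof -
      \<comment> \<open>A step inserts at most one task and extracts one, so a task left over was
        accompanied by one already queued.\<close>
      have "queue s \<noteq> {}"
        using that run_task by (cases "last_task s i" rule: released_cases) auto
      then show ?thesis using A1 run_task by simp
    qed
    show "queue s' \<inter> dom (plan s') = {}"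
      using A3 R A9 run_task unfolding D by (simp) blast
    show "job_of y < jobs I" if "y \<in> queue s \<union> dom (plan s) \<union> ?R" for y
      using that
    proof
      assume "y \<in> ?R"
      then obtain j where "y = Exec j" "Test j \<in> dom (plan s)" using R A9 run_task by blast
      then show ?thesis using A4 by force
    qed (use A4 in blast)
    show "Untested j \<in> queue s \<union> dom (plan s) \<union> ?R \<longleftrightarrow> \<not> tested \<alpha> I j" if "j < jobs I" for j
      using that A5 R by blast
    show "Test j \<in> queue s \<union> dom (plan s) \<union> ?R \<longleftrightarrow> tested \<alpha> I j" if "j < jobs I" for j
      using that A6 R by blast
    show "Test j \<in> dom (plan s')" if "Exec j \<in> queue s \<union> dom (plan s) \<union> ?R" for j
      using that A7 R A9 run_task(2) unfolding D by blast
    show "Exec j \<in> queue s \<union> dom (plan s) \<union> ?R \<or> (\<exists>i\<in>active s'. last_task s' i = Some (Test j))"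
      if "Test j \<in> dom (plan s')" for j
    proof (cases "x = Test j")
      case True
      then show ?thesis using run_task by auto
    next
      case False
      then have "Test j \<in> dom (plan s)" using that D by auto
      then consider "Exec j \<in> queue s \<union> dom (plan s)"
        | k where "k \<in> active s" "last_task s k = Some (Test j)" using A8 by blast
      then show ?thesis
      proof cases
        case 2
        then show ?thesis using R' run_task by (cases "k = i") auto
      qed blast
    qed
    fix k j assume k: "k \<in> active s'" and l: "last_task s' k = Some (Test j)"
    have "Test j \<in> dom (plan s') \<and> Exec j \<notin> queue s \<union> dom (plan s) \<union> ?R \<and> machine (plan s') (Test j) = k"
    proof (cases "k = i")
      case True
      then have x: "x = Test j" using l run_task by simp
      then have "Exec j \<notin> queue s \<union> dom (plan s) \<union> ?R" using new A7 R A9 run_task(2) by blast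
      then show ?thesis using x True run_task(1) by simp
    next
      case False
      then have kj: "last_task s k = Some (Test j)" "k \<in> active s" using l k run_task(1) by auto
      then have "Test j \<in> dom (plan s)" "machine (plan s) (Test j) = k" using A9 by blast+
      moreover have "Exec j \<notin> ?R"
        using R[of "Exec j"] A9 False calculation run_task(2) by blast
      moreover have "x \<noteq> Test j" using new calculation by blast
      ultimately show ?thesis using A9 kj run_task(1) by simp
    qed
    then show "Test j \<in> dom (plan s')" "Exec j \<notin> queue s \<union> dom (plan s) \<union> ?R"
      "machine (plan s') (Test j) = k" by blast+
  qed
next
  case (stay_idle i)
  then have l: "last_task s i \<noteq> Some (Test j)" for j by auto
  then have "(\<exists>k\<in>active s. last_task s k = Some (Test j)) \<longleftrightarrow>
      (\<exists>k\<in>active s'. last_task s' k = Some (Test j))" for j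
    using stay_idle(1) by auto
  moreover have "queue s = {}" "queue s' = {}" "plan s' = plan s" "active s' \<subseteq> active s" "last_task s' = last_task s"
    using stay_idle by auto
  ultimately show ?thesis using assms(2) unfolding task_inv_def by simp blast
qed

lemma step_new_task:
  assumes "task_inv m \<alpha> I s" "i \<in> active s" "x \<in> queue s \<union> released (last_task s i)"
  shows "x \<notin> dom (plan s)"
proof -
  have "queue s \<inter> dom (plan s) = {}"
    "\<And>j. last_task s i = Some (Test j) \<Longrightarrow> Exec j \<notin> dom (plan s)"
    using assms(1,2) unfolding task_inv_def by blast+
  then show ?thesis
    using assms(3) by (cases "last_task s i" rule: released_cases) auto
qed

lemma time_inv_init: "time_inv m I (pcpm_init m \<alpha> I)"
  unfolding time_inv_def pcpm_init_def by auto

lemma time_inv_step: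
  assumes "pcpm_step \<beta> I s s'" "task_inv m \<alpha> I s" "time_inv m I s"
    "valid_instance I" "finite (dom (plan s))"
  shows "time_inv m I s'"
  using assms(1)
proof cases
  case (run_task i Q x)
  have new: "x \<notin> dom (plan s)" using step_new_task[OF assms(2)] run_task by blast
  have im: "i < m" using run_task assms(2) by (auto simp: task_inv_def)
  have jx: "job_of x < jobs I"
    using task_inv_step[OF assms(1,2)] run_task unfolding task_inv_def by auto
  then have dx: "0 \<le> duration I x" by (rule duration_nonneg[OF assms(4)])
  have T: "\<forall>i. 0 \<le> free_at s i"
    "\<forall>x\<in>dom (plan s). machine (plan s) x < m \<and> 0 \<le> start (plan s) x \<and>
      finish I (plan s) x \<le> free_at s (machine (plan s) x)"
    "\<forall>x\<in>dom (plan s). \<forall>y\<in>dom (plan s). x \<noteq> y \<and> machine (plan s) x = machine (plan s) y \<longrightarrow>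
      finish I (plan s) x \<le> start (plan s) y \<or> finish I (plan s) y \<le> start (plan s) x"
    "\<forall>i\<in>active s. \<forall>j. last_task s i = Some (Test j) \<longrightarrow> finish I (plan s) (Test j) = free_at s i"
    "\<forall>j. Exec j \<in> dom (plan s) \<longrightarrow> finish I (plan s) (Test j) \<le> start (plan s) (Exec j)"
    "\<forall>j. Exec j \<in> queue s \<longrightarrow> (\<forall>k\<in>active s. finish I (plan s) (Test j) \<le> free_at s k)"
    "(\<Sum>i<m. free_at s i) = (\<Sum>x\<in>dom (plan s). duration I x)"
    using assms(3) unfolding time_inv_def by blast+
  have D: "dom (plan s') = insert x (dom (plan s))" using run_task by auto
  have mono: "free_at s k \<le> free_at s' k" for k using run_task dx by simp
  have testD: "Test j \<in> dom (plan s)" if "Exec j \<in> queue s \<union> released (last_task s i)" for j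
    using that assms(2) run_task(2) by (cases "last_task s i" rule: released_cases) (auto simp: task_inv_def)
  \<comment> \<open>A newly released execution has its test end at \<open>free_at s i\<close>, which
    is minimal among the active machines.\<close>
  have rel: "\<forall>k\<in>active s. finish I (plan s) (Test j) \<le> free_at s k"
    if "Exec j \<in> queue s \<union> released (last_task s i)" for j
    using that run_task(2,3) T(4,6) by (cases "last_task s i" rule: released_cases) auto
  show ?thesis unfolding time_inv_def
  proof (intro conjI)
    show "\<forall>i. 0 \<le> free_at s' i" using T(1) mono order_trans by blast
    show "\<forall>y\<in>dom (plan s'). machine (plan s') y < m \<and> 0 \<le> start (plan s') y \<and>
      finish I (plan s') y \<le> free_at s' (machine (plan s') y)"
    proof
      fix y assume "y \<in> dom (plan s')"
      then consider "y = x" | "y \<noteq> x" "y \<in> dom (plan s)" using D by auto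
      then show "machine (plan s') y < m \<and> 0 \<le> start (plan s') y \<and>
        finish I (plan s') y \<le> free_at s' (machine (plan s') y)"
      proof cases
        case 1
        then show ?thesis using im T(1) run_task(1) by simp
      next
        case 2
        then have "machine (plan s) y < m" "0 \<le> start (plan s) y"
          "finish I (plan s) y \<le> free_at s (machine (plan s) y)" using T(2) by blast+
        moreover have "machine (plan s') y = machine (plan s) y" "start (plan s') y = start (plan s) y"
          "finish I (plan s') y = finish I (plan s) y" using 2(1) run_task(1) by simp_all
        ultimately show ?thesis using mono[of "machine (plan s) y"] by simp
      qed
    qed
    show "\<forall>y\<in>dom (plan s'). \<forall>z\<in>dom (plan s'). y \<noteq> z \<and> machine (plan s') y = machine (plan s') z \<longrightarrow>
      finish I (plan s') y \<le> start (plan s') z \<or> finish I (plan s') z \<le> start (plan s') y"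
      using T(2,3) run_task(1) unfolding D by simp blast
    show "\<forall>k\<in>active s'. \<forall>j. last_task s' k = Some (Test j) \<longrightarrow> finish I (plan s') (Test j) = free_at s' k"
    proof (intro ballI allI impI)
      fix k j assume kj: "k \<in> active s'" "last_task s' k = Some (Test j)"
      show "finish I (plan s') (Test j) = free_at s' k"
      proof (cases "k = i")
        case True
        then show ?thesis using kj run_task(1) by simp
      next
        case False
        then have "k \<in> active s" "last_task s k = Some (Test j)" using kj run_task(1) by auto
        moreover from this have "Test j \<in> dom (plan s)" using assms(2) unfolding task_inv_def by blast
        ultimately show ?thesis using T(4) False new run_task(1) by auto
      qed
    qed
    show "\<forall>j. Exec j \<in> dom (plan s') \<longrightarrow> finish I (plan s') (Test j) \<le> start (plan s') (Exec j)"
    proof (intro allI impI)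
      fix j assume "Exec j \<in> dom (plan s')"
      then consider "x = Exec j" | "x \<noteq> Exec j" "Exec j \<in> dom (plan s)" using D by auto
      then show "finish I (plan s') (Test j) \<le> start (plan s') (Exec j)"
      proof cases
        case 1
        then show ?thesis using rel[of j] run_task by simp
      next
        case 2
        then have "x \<noteq> Test j" using new assms(2) unfolding task_inv_def by blast
        then show ?thesis using T(5) 2 run_task(1) by simp
      qed
    qed
    show "\<forall>j. Exec j \<in> queue s' \<longrightarrow> (\<forall>k\<in>active s'. finish I (plan s') (Test j) \<le> free_at s' k)"
    proof (intro allI impI ballI)
      fix j k assume "Exec j \<in> queue s'" "k \<in> active s'"
      then have q: "Exec j \<in> queue s \<union> released (last_task s i)" "k \<in> active s" using run_task by auto
      then have "x \<noteq> Test j" using testD new by blast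
      then have "finish I (plan s') (Test j) \<le> free_at s k" using rel q run_task(1) by simp
      then show "finish I (plan s') (Test j) \<le> free_at s' k" using mono order_trans by blast
    qed
    have "(\<Sum>k<m. free_at s' k) = (\<Sum>k<m. free_at s k + (if k = i then duration I x else 0))"
      using run_task(1) by (intro sum.cong) auto
    also have "\<dots> = (\<Sum>k<m. free_at s k) + duration I x"
      using im by (simp add: sum.distrib)
    finally show "(\<Sum>k<m. free_at s' k) = (\<Sum>y\<in>dom (plan s'). duration I y)"
      unfolding D using T(7) new assms(5) by simp
  qed
next
  case (stay_idle i)
  then show ?thesis using assms(3) unfolding time_inv_def by simp
qed

lemma queue_heavy_step:
  assumes "pcpm_step \<beta> I s s'" "queue_heavy \<beta> I s"
  shows "queue_heavy \<beta> I s'"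
  using assms(1)
proof cases
  case (run_task i Q x)
  show ?thesis unfolding queue_heavy_def
  proof (intro ballI)
    fix y z assume "y \<in> queue s'" "z \<in> dom (plan s')"
    then have y: "y \<in> queue s \<union> released (last_task s i)" "y \<noteq> x" and z: "z = x \<or> z \<in> dom (plan s)"
      using run_task by auto
    have le: "weight \<beta> I x \<le> weight \<beta> I y" using y run_task by blast
    \<comment> \<open>At most one task is released, so \<open>x\<close> and \<open>y\<close> are not
      both new. An old \<open>y\<close> is bounded by the invariant directly, an old
      \<open>x\<close> through the comparison of \<open>x\<close> with \<open>y\<close>.\<close>
    have "y \<in> queue s \<or> x \<in> queue s"
      using y run_task by (cases "last_task s i" rule: released_cases) auto
    then show "weight \<beta> I z \<le> weight \<beta> I y"
      using z le assms(2) unfolding queue_heavy_def by (meson order_trans)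
  qed
next
  case (stay_idle i)
  then show ?thesis using assms(2) unfolding queue_heavy_def by simp
qed

lemma history_step:
  assumes "pcpm_step \<beta> I s s'" "task_inv m \<alpha> I s" "time_inv m I s" "queue_heavy \<beta> I s"
    and "history m \<beta> I (plan s) B"
  shows "\<exists>B. history m \<beta> I (plan s') B"
  using assms(1)
proof cases
  case (run_task i Q x)
  have new: "x \<notin> dom (plan s)" using step_new_task[OF assms(2)] run_task by blast
  define B' where "B' = B(x := dom (plan s))"
  have D: "dom (plan s') = insert x (dom (plan s))" using run_task by auto
  have H: "\<And>y. y \<in> dom (plan s) \<Longrightarrow> B y \<subseteq> dom (plan s) - {y} \<and> (\<forall>z\<in>B y. B z \<subseteq> B y)"
    "\<And>y. y \<in> dom (plan s) \<Longrightarrow> starts_from_queue m \<beta> I (plan s) B y \<or>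
      (\<exists>j. y = Exec j \<and> start (plan s) (Exec j) = finish I (plan s) (Test j))"
    "\<And>j. Exec j \<in> dom (plan s) \<Longrightarrow> Test j \<in> B (Exec j)"
    using assms(5) unfolding history_def by blast+
  have B': "B' x = dom (plan s)" "\<And>y. y \<in> dom (plan s) \<Longrightarrow> B' y = B y"
    using new by (auto simp: B'_def)
  have "history m \<beta> I (plan s') B'" unfolding history_def
  proof (intro conjI ballI allI impI)
    fix y assume "y \<in> dom (plan s')"
    then consider "y = x" | "y \<noteq> x" "y \<in> dom (plan s)" using D by auto
    note y = this
    show "B' y \<subseteq> dom (plan s') - {y}"
      using y
    proof cases
      case 1
      then show ?thesis using B' new D by simp
    next
      case 2
      then show ?thesis using B'(2) D H(1)[of y] by blast
    qed
    show "B' z \<subseteq> B' y" if "z \<in> B' y" for z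
      using y
    proof cases
      case 1
      then show ?thesis using that B' H(1)[of z] by auto
    next
      case 2
      then have "z \<in> B y" "z \<in> dom (plan s)" using that B' H(1) by blast+
      then show ?thesis using 2 B' H(1)[of y] by simp
    qed
    show "starts_from_queue m \<beta> I (plan s') B' y \<or>
        (\<exists>j. y = Exec j \<and> start (plan s') (Exec j) = finish I (plan s') (Test j))"
      using y
    proof cases
      case 1
      show ?thesis
      proof (cases "x \<in> queue s")
        case True
        then have act: "active s = {..<m}" using assms(2) unfolding task_inv_def by blast
        \<comment> \<open>Machine \<open>i\<close> is the earliest to become free and all machines
          are active, so its time is at most the average load of the started tasks.\<close>
        have "real m * free_at s i = (\<Sum>k<m. free_at s i)" by simp
        also have "\<dots> \<le> (\<Sum>k<m. free_at s k)" using act run_task(3) by (intro sum_mono) simp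
        also have "\<dots> = (\<Sum>z\<in>dom (plan s). duration I z)" using assms(3) unfolding time_inv_def by blast
        finally have "starts_from_queue m \<beta> I (plan s') B' x"
          using run_task(1) True assms(4) B' by (simp add: starts_from_queue_def queue_heavy_def)
        then show ?thesis using 1 by simp
      next
        case False
        \<comment> \<open>A task taken without having waited is the execution of the test that has
          just ended on this machine.\<close>
        then have "x \<in> released (last_task s i)" using run_task by blast
        then obtain j where j: "last_task s i = Some (Test j)" "x = Exec j"
          by (cases "last_task s i" rule: released_cases) auto
        then have "finish I (plan s) (Test j) = free_at s i"
          using assms(3) run_task(2) unfolding time_inv_def by blast
        then show ?thesis using 1 j run_task(1) by simp
      qed
    next
      case 2
      from H(2)[OF 2(2)] show ?thesis
      proof
        assume "starts_from_queue m \<beta> I (plan s) B y"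
        then show ?thesis using 2 B' run_task(1) by (simp add: starts_from_queue_def)
      next
        assume "\<exists>j. y = Exec j \<and> start (plan s) (Exec j) = finish I (plan s) (Test j)"
        then obtain j where j: "y = Exec j" "start (plan s) (Exec j) = finish I (plan s) (Test j)" by blast
        then have "x \<noteq> Test j" using new 2 H(1,3) by blast
        then show ?thesis using j 2 run_task(1) by simp
      qed
    qed
  next
    fix j assume "Exec j \<in> dom (plan s')"
    then consider "Exec j = x" | "Exec j \<in> dom (plan s)" using D by blast
    then show "Test j \<in> B' (Exec j)"
    proof cases
      case 1
      then have "Test j \<in> dom (plan s)"
        using assms(2) run_task(2,4,5)
        by (cases "last_task s i" rule: released_cases) (auto simp: task_inv_def)
      then show ?thesis using 1 B' by simp
    next
      case 2
      then show ?thesis using H(3) B' by simp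
    qed
  qed
  then show ?thesis by blast
next
  case (stay_idle i)
  then show ?thesis using assms(5) by auto
qed

section \<open>Reachable states, feasibility and termination\<close>

definition run_inv :: "nat \<Rightarrow> real \<Rightarrow> real \<Rightarrow> job_instance \<Rightarrow> pcpm_state \<Rightarrow> bool" where
  "run_inv m \<alpha> \<beta> I s \<longleftrightarrow> finite (queue s) \<and> finite (dom (plan s)) \<and> task_inv m \<alpha> I s \<and>
    time_inv m I s \<and> queue_heavy \<beta> I s \<and> (\<exists>B. history m \<beta> I (plan s) B)"

lemma finite_step:
  assumes "pcpm_step \<beta> I s s'" "finite (queue s)" "finite (dom (plan s))"
  shows "finite (queue s')" "finite (dom (plan s'))"
  using assms(1)
proof (atomize(full), cases)
  case (run_task i Q x)
  have "finite (released (last_task s i))" by (cases "last_task s i" rule: released_cases) auto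
  then show "finite (queue s') \<and> finite (dom (plan s'))" using run_task assms(2,3) by simp
qed (use assms(2,3) in simp)

lemma run_inv_init: "run_inv m \<alpha> \<beta> I (pcpm_init m \<alpha> I)"
proof -
  have "history m \<beta> I Map.empty (\<lambda>_. {})" by (simp add: history_def)
  then have "\<exists>B. history m \<beta> I (plan (pcpm_init m \<alpha> I)) B" unfolding pcpm_init_def by auto
  then show ?thesis unfolding run_inv_def
    using task_inv_init[of m \<alpha> I] time_inv_init[of m I \<alpha>] by (simp add: queue_heavy_def pcpm_init_def)
qed

lemma run_inv_step:
  assumes "pcpm_step \<beta> I s s'" "run_inv m \<alpha> \<beta> I s" "valid_instance I"
  shows "run_inv m \<alpha> \<beta> I s'"
  using assms(2) finite_step[OF assms(1)] task_inv_step[OF assms(1)]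
    time_inv_step[OF assms(1) _ _ assms(3)] queue_heavy_step[OF assms(1)] history_step[OF assms(1)]
  unfolding run_inv_def by blast

lemma run_inv_reachable:
  assumes "(pcpm_step \<beta> I)\<^sup>*\<^sup>* (pcpm_init m \<alpha> I) s" "valid_instance I"
  shows "run_inv m \<alpha> \<beta> I s"
  using assms(1) by induction (use run_inv_init run_inv_step assms(2) in blast)+

lemma pcpm_feasible:
  assumes "run_inv m \<alpha> \<beta> I s" "active s = {}" "1 \<le> m"
  shows "feasible m I (plan s)"
    and "\<And>j. j < jobs I \<Longrightarrow> Untested j \<in> dom (plan s) \<longleftrightarrow> \<not> tested \<alpha> I j"
proof -
  have t: "task_inv m \<alpha> I s" "time_inv m I s" using assms(1) by (auto simp: run_inv_def)
  have q: "queue s = {}"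
  proof (rule ccontr)
    assume "queue s \<noteq> {}"
    then have "{..<m} = {}" using t(1) assms(2) unfolding task_inv_def by blast
    then show False using assms(3) by (simp add: lessThan_empty_iff)
  qed
  \<comment> \<open>With an empty queue and no active machine, no execution is pending, so every
    test in the plan has its execution there too.\<close>
  have T: "\<forall>x\<in>dom (plan s). job_of x < jobs I"
    "\<forall>j<jobs I. Untested j \<in> dom (plan s) \<longleftrightarrow> \<not> tested \<alpha> I j"
    "\<forall>j<jobs I. Test j \<in> dom (plan s) \<longleftrightarrow> tested \<alpha> I j"
    "\<forall>j. Exec j \<in> dom (plan s) \<longleftrightarrow> Test j \<in> dom (plan s)"
    using t(1) q assms(2) unfolding task_inv_def by (simp_all) blast
  show "Untested j \<in> dom (plan s) \<longleftrightarrow> \<not> tested \<alpha> I j" if "j < jobs I" for j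
    using T(2) that by blast
  show "feasible m I (plan s)" unfolding feasible_def
  proof (intro conjI)
    show "\<forall>x\<in>dom (plan s). job_of x < jobs I \<and> machine (plan s) x < m \<and> 0 \<le> start (plan s) x"
      using T(1) t(2) unfolding time_inv_def by blast
    show "\<forall>j<jobs I. (Untested j \<in> dom (plan s) \<and> Test j \<notin> dom (plan s) \<and> Exec j \<notin> dom (plan s)) \<or>
        (Untested j \<notin> dom (plan s) \<and> Test j \<in> dom (plan s) \<and> Exec j \<in> dom (plan s) \<and>
         finish I (plan s) (Test j) \<le> start (plan s) (Exec j))"
    proof (intro allI impI)
      fix j assume j: "j < jobs I"
      have "finish I (plan s) (Test j) \<le> start (plan s) (Exec j)" if "Exec j \<in> dom (plan s)"
        using that t(2) unfolding time_inv_def by blast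
      then show "(Untested j \<in> dom (plan s) \<and> Test j \<notin> dom (plan s) \<and> Exec j \<notin> dom (plan s)) \<or>
          (Untested j \<notin> dom (plan s) \<and> Test j \<in> dom (plan s) \<and> Exec j \<in> dom (plan s) \<and>
           finish I (plan s) (Test j) \<le> start (plan s) (Exec j))"
        using T(2-4) j by blast
    qed
    show "\<forall>x\<in>dom (plan s). \<forall>y\<in>dom (plan s). x \<noteq> y \<and> machine (plan s) x = machine (plan s) y \<longrightarrow>
        finish I (plan s) x \<le> start (plan s) y \<or> finish I (plan s) y \<le> start (plan s) x"
      using t(2) unfolding time_inv_def by blast
  qed
qed

lemma pcpm_progress:
  assumes "run_inv m \<alpha> \<beta> I s" "active s \<noteq> {}"
  shows "\<exists>s'. pcpm_step \<beta> I s s'"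
proof -
  have "finite (active s)"
    using assms(1) finite_subset[of "active s" "{..<m}"] by (simp add: run_inv_def task_inv_def)
  then have "arg_min_on (free_at s) (active s) \<in> active s"
    "\<And>k. k \<in> active s \<Longrightarrow> free_at s (arg_min_on (free_at s) (active s)) \<le> free_at s k"
    using assms(2) by (auto intro: arg_min_if_finite(1) arg_min_least)
  then obtain i where i: "i \<in> active s" "\<forall>k\<in>active s. free_at s i \<le> free_at s k" by blast
  define Q where "Q = queue s \<union> released (last_task s i)"
  have fQ: "finite Q"
    using assms(1) by (cases "last_task s i" rule: released_cases) (auto simp: Q_def run_inv_def)
  show ?thesis
  proof (cases "Q = {}")
    case True
    then show ?thesis using pcpm_step.stay_idle[OF i] unfolding Q_def by blast
  next
    case False
    then have "arg_min_on (weight \<beta> I) Q \<in> Q"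
      "\<forall>y\<in>Q. weight \<beta> I (arg_min_on (weight \<beta> I) Q) \<le> weight \<beta> I y"
      using fQ by (auto intro: arg_min_if_finite(1) arg_min_least)
    then show ?thesis using pcpm_step.run_task[OF i Q_def] by blast
  qed
qed

text \<open>The number of active machines plus the number of unstarted tasks among all conceivable
  ones decreases in every step, and a step is possible while a machine is active.\<close>

lemma pcpm_terminates:
  assumes "run_inv m \<alpha> \<beta> I s" "valid_instance I"
  shows "\<exists>s'. (pcpm_step \<beta> I)\<^sup>*\<^sup>* s s' \<and> active s' = {}"
proof -
  define U where "U = Test ` {..<jobs I} \<union> Exec ` {..<jobs I} \<union> Untested ` {..<jobs I}"
  have fU: "finite U" by (simp add: U_def)
  have U: "x \<in> U" if "job_of x < jobs I" for x using that by (cases x) (auto simp: U_def)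
  show ?thesis using assms(1)
  proof (induction "card (active s) + card (U - dom (plan s))" arbitrary: s rule: less_induct)
    case less
    show ?case
    proof (cases "active s = {}")
      case False
      then obtain s' where s': "pcpm_step \<beta> I s s'" using pcpm_progress[OF less.prems] by blast
      have t: "task_inv m \<alpha> I s" using less.prems by (simp add: run_inv_def)
      then have fa: "finite (active s)"
        using finite_subset[of "active s" "{..<m}"] by (simp add: task_inv_def)
      have inv': "run_inv m \<alpha> \<beta> I s'" by (rule run_inv_step[OF s' less.prems assms(2)])
      have "card (active s') + card (U - dom (plan s')) < card (active s) + card (U - dom (plan s))"
        using s'
      proof cases
        case (run_task i Q x)
        have "x \<in> dom (plan s')" using run_task by simp
        then have "x \<in> U" using inv' U unfolding run_inv_def task_inv_def by blast
        moreover have "x \<notin> dom (plan s)" using step_new_task[OF t] run_task by blast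
        moreover have "dom (plan s') = insert x (dom (plan s))" using run_task by auto
        ultimately have "card (U - dom (plan s')) < card (U - dom (plan s))"
          using fU by (intro psubset_card_mono) auto
        then show ?thesis using run_task by simp
      next
        case (stay_idle i)
        then have "card (active s') < card (active s)" using fa card_Diff1_less[of "active s" i] by simp
        then show ?thesis using stay_idle(1) by simp
      qed
      then obtain s'' where "(pcpm_step \<beta> I)\<^sup>*\<^sup>* s' s''" "active s'' = {}"
        using less.hyps inv' by blast
      then show ?thesis using s' by (meson converse_rtranclp_into_rtranclp)
    qed blast
  qed
qed

lemma pcpm_exists:
  assumes "valid_instance I"
  shows "\<exists>S. pcpm \<alpha> \<beta> m I S"
  using pcpm_terminates[OF run_inv_init assms] unfolding pcpm_def by blast

section \<open>Tested pairs\<close>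

text \<open>
  A pair of tested jobs may cause a delay of up to \<open>\<beta>\<close>, more than \<open>sqrt 5\<close> times the smaller
  minimum time, if the longer job of the pair runs first. Pairs of jobs of equal kind pay for this: the levels
  are chosen so that every pair leaves a surplus of at least the product of its two levels, and these
  products add up to a square.
\<close>

definition level :: "real \<Rightarrow> real \<Rightarrow> real" where
  "level \<beta> p = (if 1 + p \<le> 11 / 10 then 1 else if 1 + p \<le> \<beta> then - 1 / 10 else 0)"

text \<open>Testing times are scaled to one. The critical pair has one job of level \<open>1\<close>
  and one of level \<open>- 1 / 10\<close>: its delay can reach \<open>\<beta>\<close>, exceeding
  \<open>2 * \<phi> - 1\<close> by less than \<open>1 / 10\<close>, and the negative product covers
  this. Pairs of equal positive or negative level have enough slack to pay their positive
  product.\<close>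

lemma tested_pair_bound_unit:
  fixes \<phi> \<beta> a b p q c :: real
  assumes \<phi>: "\<phi>\<^sup>2 = \<phi> + 1" "1.618 \<le> \<phi>" and \<beta>: "2.316 \<le> \<beta>" "\<beta> \<le> 2.3166"
    and pq: "0 \<le> p" "0 \<le> q"
    and a: "min (max \<phi> p) (1 + p) \<le> a" and b: "min (max \<phi> q) (1 + q) \<le> b"
    and c: "c \<le> 1 \<or> c \<le> 1 + p \<and> 1 + p \<le> \<beta> \<or> c \<le> 2 + min p q \<and> \<beta> - 1 \<le> max p q"
  shows "c \<le> (2 * \<phi> - 1) * min a b - level \<beta> p * level \<beta> q"
proof -
  define \<mu> where "\<mu> = min a b"
  have lower: "min (max \<phi> (min p q)) (1 + min p q) \<le> \<mu>"
    using a b unfolding \<mu>_def by (auto simp: min_def max_def split: if_splits)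
  have \<mu>1: "1 \<le> \<mu>" using lower pq \<phi>(2) by (auto simp: min_def max_def split: if_splits)
  have "(\<phi> - 2) * (\<phi> + 1) < 0" using \<phi>(1) by (simp add: power2_eq_square algebra_simps)
  then have \<phi>2: "\<phi> \<le> 2" using \<phi>(2) by (simp add: mult_less_0_iff)
  define w where "w = (2 * \<phi> - 1) * \<mu>"
  \<comment> \<open>\<open>559 / 250 = 2 * 1.618 - 1\<close> turns most cases into linear arithmetic
    with rational coefficients.\<close>
  have s: "559 / 250 * \<mu> \<le> w"
    unfolding w_def using \<mu>1 \<phi>(2) by (intro mult_right_mono) auto
  have "c \<le> w - level \<beta> p * level \<beta> q"
    using c
  proof (elim disjE)
    assume "c \<le> 1"
    then show ?thesis using s \<mu>1 by (auto simp: level_def)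
  next
    assume "c \<le> 1 + p \<and> 1 + p \<le> \<beta>"
    moreover have "1 + q \<le> \<beta> \<or> min \<phi> (1 + p) \<le> \<mu>"
      using a b \<beta> \<phi>2 unfolding \<mu>_def by (auto simp: min_def max_def split: if_splits)
    moreover have "11 / 10 \<le> 1 + p \<and> 11 / 10 \<le> 1 + q \<Longrightarrow> 11 / 10 \<le> \<mu>"
      using a b \<phi>(2) unfolding \<mu>_def by (auto simp: min_def max_def split: if_splits)
    ultimately show ?thesis using s \<mu>1 \<beta> \<phi>(2) pq
      unfolding level_def min_def by (simp split: if_splits; linarith)
  next
    assume c2: "c \<le> 2 + min p q \<and> \<beta> - 1 \<le> max p q"
    show ?thesis
    proof (cases "level \<beta> p * level \<beta> q > 0")
      case True
      \<comment> \<open>Two jobs of level \<open>1\<close> are too short for this alternative, so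
        both have level \<open>- 1 / 10\<close> and the longer one satisfies
        \<open>1 + max p q = \<beta>\<close>.\<close>
      then have "level \<beta> p * level \<beta> q = 1 / 100" "min p q \<le> 1.3166"
        using c2 \<beta> by (auto simp: level_def max_def min_def split: if_splits)
      then show ?thesis using c2 s lower \<phi>(2) pq by (auto simp: min_def max_def split: if_splits)
    next
      case False
      define r where "r = min p q"
      have r: "0 \<le> r" using pq by (simp add: r_def)
      have "2 + r \<le> w"
      proof (cases "1 + r \<le> \<mu>")
        case True
        then show ?thesis using s r by linarith
      next
        case 1: False
        then have m: "\<phi> \<le> \<mu>" "r \<le> \<mu>" using lower unfolding r_def by (auto simp: min_def split: if_splits)
        \<comment> \<open>Here
          \<open>(2 * \<phi> - 1) * \<mu> = \<mu> + 2 * (\<phi> - 1) * \<mu>\<close>, where the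
          first term is at least \<open>r\<close> and the second at least \<open>2\<close>. Equality
          at \<open>\<mu> = r = \<phi>\<close> is the extremal pair.\<close>
        have "\<phi> * (\<phi> - 1) = 1" using \<phi>(1) by (simp add: power2_eq_square algebra_simps)
        moreover have "\<phi> * (\<phi> - 1) \<le> \<mu> * (\<phi> - 1)" using m \<phi>(2) by (intro mult_right_mono) auto
        ultimately show ?thesis using m by (simp add: w_def algebra_simps)
      qed
      then show ?thesis using c2 False unfolding r_def by linarith
    qed
  qed
  then show ?thesis by (simp add: \<mu>_def w_def)
qed

lemma tested_pair_bound:
  fixes \<phi> \<beta> \<tau> u v p q c :: real
  assumes \<phi>: "\<phi>\<^sup>2 = \<phi> + 1" "1.618 \<le> \<phi>" and \<beta>: "2.316 \<le> \<beta>" "\<beta> \<le> 2.3166"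
    and \<tau>: "0 < \<tau>" and pq: "0 \<le> p" "0 \<le> q" "p \<le> u" "q \<le> v" "\<phi> * \<tau> \<le> u" "\<phi> * \<tau> \<le> v"
    and c: "c \<le> \<tau> \<or> c \<le> \<tau> + p \<and> \<tau> + p \<le> \<beta> * \<tau> \<or> c \<le> \<tau> + q \<and> \<tau> + q \<le> \<beta> * \<tau> \<or>
      c \<le> 2 * \<tau> + min p q \<and> (\<beta> - 1) * \<tau> \<le> max p q"
  shows "c \<le> (2 * \<phi> - 1) * min (min u (\<tau> + p)) (min v (\<tau> + q)) - \<tau> * (level \<beta> (p / \<tau>) * level \<beta> (q / \<tau>))"
proof -
  have sc: "min (x / \<tau>) (y / \<tau>) = min x y / \<tau>" "max (x / \<tau>) (y / \<tau>) = max x y / \<tau>" for x y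
    using \<tau> by (auto simp: min_def max_def divide_right_mono divide_le_cancel)
  have one: "1 + x / \<tau> = (\<tau> + x) / \<tau>" for x using \<tau> by (simp add: add_divide_distrib)
  have A: "min (max \<phi> (p / \<tau>)) (1 + p / \<tau>) \<le> min u (\<tau> + p) / \<tau>"
    and B: "min (max \<phi> (q / \<tau>)) (1 + q / \<tau>) \<le> min v (\<tau> + q) / \<tau>"
    unfolding sc(1)[symmetric] one using pq \<tau>
    by (intro min.mono; simp add: field_simps)+
  note unit = tested_pair_bound_unit[OF \<phi> \<beta>]
  have "c / \<tau> \<le> (2 * \<phi> - 1) * min (min u (\<tau> + p) / \<tau>) (min v (\<tau> + q) / \<tau>)
      - level \<beta> (p / \<tau>) * level \<beta> (q / \<tau>)"
  \<comment> \<open>The scaled bound has this alternative for its first job only, so the roles of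
    the jobs are exchanged.\<close>
  proof (cases "c \<le> \<tau> + q \<and> \<tau> + q \<le> \<beta> * \<tau>")
    case True
    then have "c / \<tau> \<le> 1 + q / \<tau> \<and> 1 + q / \<tau> \<le> \<beta>" using \<tau> by (simp add: field_simps)
    then show ?thesis using unit[OF _ _ B A] pq \<tau> by (simp add: min.commute mult.commute)
  next
    case False
    then have "c / \<tau> \<le> 1 \<or> c / \<tau> \<le> 1 + p / \<tau> \<and> 1 + p / \<tau> \<le> \<beta> \<or>
        c / \<tau> \<le> 2 + min (p / \<tau>) (q / \<tau>) \<and> \<beta> - 1 \<le> max (p / \<tau>) (q / \<tau>)"
      using c \<tau> unfolding sc by (auto simp: field_simps)
    then show ?thesis using unit[OF _ _ A B] pq \<tau> by simp
  qed
  then show ?thesis unfolding sc using \<tau> by (simp add: field_simps)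
qed

section \<open>Cost of a run\<close>

text \<open>A completed run enters only through its schedule and \<open>history\<close>. The
  condition \<open>\<alpha> < \<beta>\<close> makes every untested execution lighter than every
  test.\<close>

locale uniform_run =
  fixes m :: nat and \<alpha> \<beta> \<tau> :: real and I :: job_instance and S :: schedule and B :: "task \<Rightarrow> task set"
  assumes m: "1 \<le> m" and valid: "valid_instance I" and feas: "feasible m I S"
    and hist: "history m \<beta> I S B"
    and untested: "\<And>j. j < jobs I \<Longrightarrow> Untested j \<in> dom S \<longleftrightarrow> \<not> tested \<alpha> I j"
    and \<tau>: "0 < \<tau>" "\<And>j. j < jobs I \<Longrightarrow> t_time I j = \<tau>"
    and \<alpha>: "1 \<le> \<alpha>" "\<alpha> < \<beta>"
begin

text \<open>
  The last task of job \<open>j\<close> that had to wait in the queue: an execution that does not start from the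
  queue follows its test immediately.
\<close>

definition key :: "nat \<Rightarrow> task" where
  "key j = (if \<not> tested \<alpha> I j then Untested j
     else if starts_from_queue m \<beta> I S B (Exec j) then Exec j else Test j)"

abbreviation delay :: "nat \<Rightarrow> nat \<Rightarrow> real" where
  "delay k j \<equiv> work_in I k (B (key j))"

lemma before:
  assumes "x \<in> dom S"
  shows "B x \<subseteq> dom S" "y \<in> B x \<Longrightarrow> B y \<subseteq> B x" "y \<in> B x \<Longrightarrow> x \<notin> B y" "x \<notin> B x"
  using assms hist unfolding history_def by blast+

lemma test_before_exec: "Exec j \<in> dom S \<Longrightarrow> Test j \<in> B (Exec j)"
  using hist unfolding history_def by blast

lemma exec_before: "x \<in> dom S \<Longrightarrow> Exec k \<in> B x \<Longrightarrow> Test k \<in> B x"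
  using before(1,2) test_before_exec by blast

lemma dom_S:
  assumes "j < jobs I"
  shows "tested \<alpha> I j \<Longrightarrow> Test j \<in> dom S \<and> Exec j \<in> dom S \<and> Untested j \<notin> dom S"
    and "\<not> tested \<alpha> I j \<Longrightarrow> Test j \<notin> dom S \<and> Exec j \<notin> dom S \<and> Untested j \<in> dom S"
  using feas untested[OF assms] assms unfolding feasible_def by blast+

lemma key_dom: "j < jobs I \<Longrightarrow> key j \<in> dom S"
  using dom_S by (simp add: key_def)

lemma key_from_queue:
  assumes "j < jobs I"
  shows "starts_from_queue m \<beta> I S B (key j)"
proof (cases "tested \<alpha> I j \<and> starts_from_queue m \<beta> I S B (Exec j)")
  case False
  then have "key j = Untested j \<or> key j = Test j" by (auto simp: key_def)
  then show ?thesis using hist key_dom[OF assms] unfolding history_def by fastforce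
qed (simp add: key_def)

lemma key_weight: "j < jobs I \<Longrightarrow> y \<in> B (key j) \<Longrightarrow> weight \<beta> I y \<le> weight \<beta> I (key j)"
  using key_from_queue unfolding starts_from_queue_def by blast

lemma delay_eq:
  "delay k j = (if Test k \<in> B (key j) then t_time I k else 0) + (if Exec k \<in> B (key j) then p_time I k else 0)
    + (if Untested k \<in> B (key j) then u_time I k else 0)"
  by (simp add: work_in_def Int_insert_right)

lemma run_time_eq: "j < jobs I \<Longrightarrow> run_time I S j = (if tested \<alpha> I j then \<tau> + p_time I j else u_time I j)"
  using dom_S \<tau> by (simp add: run_time_def)

lemma key_start_le:
  assumes j: "j < jobs I"
  shows "real m * start S (key j) \<le> delay j j + (\<Sum>k<jobs I. if k = j then 0 else delay k j)"
proof -
  have "real m * start S (key j) \<le> (\<Sum>x\<in>B (key j). duration I x)"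
    using key_from_queue[OF j] by (simp add: starts_from_queue_def)
  also have "\<dots> = (\<Sum>k<jobs I. delay k j)" unfolding work_in_def
  proof (rule sum_group_by_job)
    have sub: "B (key j) \<subseteq> dom S" by (rule before(1)[OF key_dom[OF j]])
    then show "finite (B (key j))" using feasible_finite_dom[OF feas] by (rule finite_subset)
    show "job_of x < jobs I" if "x \<in> B (key j)" for x
    proof -
      have "x \<in> dom S" using that sub by blast
      then show ?thesis using feas by (simp add: feasible_def)
    qed
  qed
  also have "\<dots> = (\<Sum>k<jobs I. (if k = j then delay j j else 0) + (if k = j then 0 else delay k j))"
    by (intro sum.cong) auto
  also have "\<dots> = delay j j + (\<Sum>k<jobs I. if k = j then 0 else delay k j)"
    using j by (simp add: sum.distrib)
  finally show ?thesis .
qed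

text \<open>If the execution waited in the queue, the job's own test adds at most
  \<open>\<tau> / m \<le> \<tau>\<close> to the bound on its start. Otherwise the execution directly
  follows the test, and the job does not precede its own key.\<close>

lemma completion_time_le:
  assumes j: "j < jobs I"
  shows "completion_time I S j \<le> (\<Sum>k<jobs I. if k = j then 0 else delay k j) / real m + run_time I S j"
proof -
  define W where "W = (\<Sum>k<jobs I. if k = j then 0 else delay k j)"
  have st: "start S (key j) \<le> W / real m + delay j j / real m"
    using key_start_le[OF j] m by (simp add: W_def field_simps)
  have d0: "0 \<le> delay j j" using valid_instanceD[OF valid j] by (simp add: delay_eq)
  have mm: "delay j j / real m \<le> delay j j" using d0 m by (simp add: divide_le_eq mult_le_cancel_left1)
  note irr = before(4)[OF key_dom[OF j]]
  have "completion_time I S j \<le> W / real m + run_time I S j"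
  proof (cases "tested \<alpha> I j")
    case False
    then have k: "key j = Untested j" by (simp add: key_def)
    have "Test j \<notin> B (key j)" "Exec j \<notin> B (key j)"
      using before(1)[OF key_dom[OF j]] dom_S(2)[OF j False] by blast+
    then have "delay j j = 0" using irr k unfolding delay_eq by simp
    then show ?thesis using st k dom_S(2)[OF j False]
      by (simp add: completion_time_def run_time_def finish_def)
  next
    case True
    note d = dom_S(1)[OF j True]
    have U: "Untested j \<notin> B (key j)" using before(1)[OF key_dom[OF j]] d by blast
    show ?thesis
    proof (cases "key j = Exec j")
      case ex: True
      then have "delay j j \<le> \<tau>" using irr U valid_instanceD[OF valid j] \<tau> j unfolding delay_eq by simp
      then show ?thesis using st mm ex d \<tau>(2)[OF j]
        by (simp add: completion_time_def run_time_def finish_def)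
    next
      case False
      then have k: "key j = Test j" "\<not> starts_from_queue m \<beta> I S B (Exec j)"
        using True by (auto simp: key_def split: if_splits)
      then have "start S (Exec j) = finish I S (Test j)" using hist d unfolding history_def by blast
      moreover have "Exec j \<notin> B (Test j)" using exec_before[OF key_dom[OF j], of j] irr k by auto
      then have "delay j j = 0" using irr U k unfolding delay_eq by simp
      ultimately show ?thesis using st k d \<tau>(2)[OF j]
        by (simp add: completion_time_def run_time_def finish_def)
    qed
  qed
  then show ?thesis by (simp add: W_def)
qed

section \<open>Mutual delays within a pair of jobs\<close>

lemma delay_untested:
  assumes "j < jobs I" "k < jobs I" "\<not> tested \<alpha> I j"
  shows "delay k j = (if Untested k \<in> B (Untested j) then u_time I k else 0)"
    "Untested k \<in> B (Untested j) \<Longrightarrow> u_time I k \<le> u_time I j"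
proof -
  have k: "key j = Untested j" using assms(3) by (simp add: key_def)
  \<comment> \<open>An untested job is lighter than any test, so no test, and hence no execution
    after a test, precedes it.\<close>
  have "u_time I j < \<alpha> * \<tau>" using assms \<tau>(2) by (simp add: tested_def)
  also have "\<alpha> * \<tau> < \<beta> * \<tau>" using \<alpha> \<tau> by simp
  finally have "Test k \<notin> B (Untested j)"
    using key_weight[OF assms(1), of "Test k"] k \<tau>(2)[OF assms(2)] by auto
  then show "delay k j = (if Untested k \<in> B (Untested j) then u_time I k else 0)"
    using exec_before[OF key_dom[OF assms(1)], of k] k unfolding delay_eq by auto
  show "u_time I k \<le> u_time I j" if "Untested k \<in> B (Untested j)"
    using key_weight[OF assms(1)] k that by fastforce
qed

lemma delay_le_untested:
  assumes "k < jobs I" "j < jobs I" "\<not> tested \<alpha> I k"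
  shows "delay k j \<le> u_time I k"
proof -
  have "Test k \<notin> B (key j)" "Exec k \<notin> B (key j)"
    using before(1)[OF key_dom[OF assms(2)]] dom_S(2)[OF assms(1,3)] by blast+
  then show ?thesis using valid_instanceD[OF valid assms(1)] by (simp add: delay_eq)
qed

text \<open>A tested \<open>k\<close> never delays \<open>j\<close>, and
  \<open>u_time I j < \<alpha> * \<tau> \<le> \<alpha> * min_time I k\<close> bounds the reverse
  delay. If both are untested, only one precedes the other, and it is the one with the smaller or
  equal upper limit.\<close>

lemma delay_pair_untested:
  assumes "j < jobs I" "k < jobs I" "j \<noteq> k" "\<not> tested \<alpha> I j"
  shows "delay k j + delay j k \<le> \<alpha> * min (min_time I j) (min_time I k)"
proof -
  note v = valid_instanceD[OF valid assms(1)] valid_instanceD[OF valid assms(2)]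
  have uj: "u_time I j \<le> \<alpha> * min_time I j" and uj': "u_time I j < \<alpha> * \<tau>"
    and uk: "\<not> tested \<alpha> I k \<Longrightarrow> u_time I k \<le> \<alpha> * min_time I k"
  proof -
    have gen: "u_time I l < \<alpha> * \<tau> \<and> u_time I l \<le> \<alpha> * min_time I l" if "l < jobs I" "\<not> tested \<alpha> I l" for l
    proof -
      note v = valid_instanceD[OF valid that(1)]
      have lt: "u_time I l < \<alpha> * \<tau>" using that \<tau>(2) by (simp add: tested_def)
      moreover have "\<alpha> * \<tau> \<le> \<alpha> * (\<tau> + p_time I l)" using \<alpha> v by simp
      moreover have "1 * u_time I l \<le> \<alpha> * u_time I l" using \<alpha> v by (intro mult_right_mono) auto
      ultimately show ?thesis using \<tau>(2)[OF that(1)] by (auto simp: min_time_def min_def)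
    qed
    show "u_time I j \<le> \<alpha> * min_time I j" "u_time I j < \<alpha> * \<tau>" using gen assms by blast+
    show "u_time I k \<le> \<alpha> * min_time I k" if "\<not> tested \<alpha> I k" using gen assms that by blast
  qed
  have mm: "\<alpha> * min (min_time I j) (min_time I k) = min (\<alpha> * min_time I j) (\<alpha> * min_time I k)"
    using \<alpha> by (simp add: min_mult_distrib_left)
  show ?thesis
  proof (cases "tested \<alpha> I k")
    case True
    have "Untested k \<notin> B (Untested j)"
      using before(1)[OF key_dom[OF assms(1)]] dom_S(1)[OF assms(2) True] assms(4) by (auto simp: key_def)
    then have "delay k j = 0" using delay_untested(1)[OF assms(1,2,4)] by simp
    moreover have "delay j k \<le> u_time I j" by (rule delay_le_untested[OF assms(1,2,4)])
    moreover have "\<alpha> * \<tau> \<le> \<alpha> * min_time I k"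
    proof (intro mult_left_mono)
      have "1 * \<tau> \<le> \<alpha> * \<tau>" using \<alpha> \<tau> by (intro mult_right_mono) auto
      then show "\<tau> \<le> min_time I k"
        using True v \<tau>(2)[OF assms(2)] unfolding tested_def min_time_def by auto
    qed (use \<alpha> in simp)
    ultimately show ?thesis using uj uj' unfolding mm by simp
  next
    case False
    have "Untested k \<in> B (Untested j) \<Longrightarrow> Untested j \<notin> B (Untested k)"
      using before(3) dom_S(2)[OF assms(1,4)] by blast
    then have "delay k j + delay j k \<le> min (u_time I j) (u_time I k)"
      using delay_untested[OF assms(1,2,4)] delay_untested[OF assms(2,1) False] v by auto
    also have "\<dots> \<le> min (\<alpha> * min_time I j) (\<alpha> * min_time I k)"
      using uj uk[OF False] by (intro min.mono)
    finally show ?thesis unfolding mm .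
  qed
qed

lemma delay_tested:
  assumes "j < jobs I" "k < jobs I" "tested \<alpha> I k"
  shows "delay k j = (if Test k \<in> B (key j) then \<tau> else 0) + (if Exec k \<in> B (key j) then p_time I k else 0)"
proof -
  have "Untested k \<notin> B (key j)"
    using before(1)[OF key_dom[OF assms(1)]] dom_S(1)[OF assms(2,3)] by blast
  then show ?thesis using \<tau>(2)[OF assms(2)] by (simp add: delay_eq)
qed

text \<open>An execution preceding a key test weighs at most \<open>\<beta> * \<tau>\<close>. If
  both keys are tests, only one job precedes the other. If \<open>key k\<close> is an execution, its
  own test precedes it, so \<open>\<tau> + q\<close> is at least \<open>\<beta> * \<tau>\<close>;
  then either all of job \<open>k\<close> precedes job \<open>j\<close>, or at most the execution of
  \<open>j\<close>, with \<open>p \<le> q\<close>, is added to the two tests.\<close>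

lemma delay_pair_key_test:
  assumes jk: "j < jobs I" "k < jobs I" "j \<noteq> k" and t: "tested \<alpha> I j" "tested \<alpha> I k"
    and key: "key j = Test j"
  defines "c \<equiv> delay k j + delay j k" and "p \<equiv> p_time I j" and "q \<equiv> p_time I k"
  shows "c \<le> \<tau> \<or> c \<le> \<tau> + p \<and> \<tau> + p \<le> \<beta> * \<tau> \<or> c \<le> \<tau> + q \<and> \<tau> + q \<le> \<beta> * \<tau> \<or>
      c \<le> 2 * \<tau> + min p q \<and> (\<beta> - 1) * \<tau> \<le> max p q"
proof -
  note d = dom_S(1)[OF jk(1) t(1)] dom_S(1)[OF jk(2) t(2)]
  note dl = delay_tested[OF jk(1,2) t(2)] delay_tested[OF jk(2,1) t(1)]
  have pq: "0 \<le> p" "0 \<le> q" using valid_instanceD[OF valid] jk by (auto simp: p_def q_def)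
  have kj: "Exec k \<in> B (Test j) \<Longrightarrow> \<tau> + q \<le> \<beta> * \<tau> \<and> Test k \<in> B (Test j)"
    using key_weight[OF jk(1), of "Exec k"] key \<tau>(2) jk exec_before[of "Test j" k] d by (auto simp: q_def)
  have key_k: "key k = Test k \<or> key k = Exec k" using t by (auto simp: key_def)
  then show ?thesis
  proof
    assume k: "key k = Test k"
    have jk': "Exec j \<in> B (Test k) \<Longrightarrow> \<tau> + p \<le> \<beta> * \<tau> \<and> Test j \<in> B (Test k)"
      using key_weight[OF jk(2), of "Exec j"] k \<tau>(2) jk exec_before[of "Test k" j] d by (auto simp: p_def)
    have "Test k \<in> B (Test j) \<Longrightarrow> Test j \<notin> B (Test k)" using before(3)[of "Test j"] d by blast
    then show ?thesis using kj jk' dl key k \<tau>(1) unfolding c_def p_def[symmetric] q_def[symmetric] by auto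
  next
    assume k: "key k = Exec k"
    show ?thesis
    proof (cases "Exec k \<in> B (Test j)")
      case True
      then have "Test j \<notin> B (Exec k)" using before(3)[of "Test j"] d by blast
      then have "Exec j \<notin> B (Exec k)" using exec_before[of "Exec k" j] d by blast
      then show ?thesis using True kj dl key k \<open>Test j \<notin> _\<close> unfolding c_def q_def by simp
    next
      case False
      have "\<beta> * \<tau> \<le> \<tau> + q"
        using key_weight[OF jk(2), of "Test k"] k \<tau>(2) jk test_before_exec[of k] d by (simp add: q_def)
      then have "(\<beta> - 1) * \<tau> \<le> max p q" by (simp add: algebra_simps)
      moreover have "Exec j \<in> B (Exec k) \<Longrightarrow> p \<le> q"
        using key_weight[OF jk(2), of "Exec j"] k \<tau>(2) jk by (simp add: p_def q_def)
      then have "c \<le> 2 * \<tau> + min p q"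
        using False dl key k \<tau>(1) pq unfolding c_def p_def[symmetric] q_def[symmetric] by auto
      ultimately show ?thesis by blast
    qed
  qed
qed

lemma delay_pair_tested:
  assumes jk: "j < jobs I" "k < jobs I" "j \<noteq> k" and t: "tested \<alpha> I j" "tested \<alpha> I k"
  defines "c \<equiv> delay k j + delay j k" and "p \<equiv> p_time I j" and "q \<equiv> p_time I k"
  shows "c \<le> \<tau> \<or> c \<le> \<tau> + p \<and> \<tau> + p \<le> \<beta> * \<tau> \<or> c \<le> \<tau> + q \<and> \<tau> + q \<le> \<beta> * \<tau> \<or>
      c \<le> 2 * \<tau> + min p q \<and> (\<beta> - 1) * \<tau> \<le> max p q"
proof -
  have "key j = Test j \<or> key j = Exec j" "key k = Test k \<or> key k = Exec k"
    using t by (auto simp: key_def)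
  then consider "key j = Test j" | "key k = Test k" | "key j = Exec j" "key k = Exec k" by blast
  then show ?thesis
  proof cases
    case 1
    then show ?thesis using delay_pair_key_test[OF jk t] unfolding c_def p_def q_def by simp
  next
    case 2
    then show ?thesis using delay_pair_key_test[OF jk(2,1) jk(3)[symmetric] t(2,1)]
      unfolding c_def p_def q_def by (simp add: add.commute min.commute max.commute) blast
  next
    case 3
    note d = dom_S(1)[OF jk(1) t(1)] dom_S(1)[OF jk(2) t(2)]
    note dl = delay_tested[OF jk(1,2) t(2)] delay_tested[OF jk(2,1) t(1)]
    have pq: "0 \<le> p" "0 \<le> q" using valid_instanceD[OF valid] jk by (auto simp: p_def q_def)
    \<comment> \<open>When both keys are executions, each one outweighs or equals its own test. Both
      tests may count, but only one execution precedes the other, and by weight it is not the longer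
      one.\<close>
    have "\<beta> * \<tau> \<le> \<tau> + q"
      using key_weight[OF jk(2), of "Test k"] 3 \<tau>(2) jk test_before_exec[of k] d by (simp add: q_def)
    then have "(\<beta> - 1) * \<tau> \<le> max p q" by (simp add: algebra_simps)
    moreover have "Exec j \<in> B (Exec k) \<Longrightarrow> p \<le> q" "Exec k \<in> B (Exec j) \<Longrightarrow> q \<le> p"
      using key_weight[OF jk(2), of "Exec j"] key_weight[OF jk(1), of "Exec k"] 3 \<tau>(2) jk
      by (simp_all add: p_def q_def)
    moreover have "Exec j \<in> B (Exec k) \<Longrightarrow> Exec k \<notin> B (Exec j)" using before(3)[of "Exec k"] d by blast
    ultimately have "c \<le> 2 * \<tau> + min p q"
      using dl 3 \<tau>(1) pq unfolding c_def p_def[symmetric] q_def[symmetric] by auto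
    then show ?thesis using \<open>(\<beta> - 1) * \<tau> \<le> max p q\<close> by blast
  qed
qed

section \<open>Own running times and summation over all pairs\<close>

lemma run_time_le:
  assumes "\<alpha>\<^sup>2 = \<alpha> + 1" "j < jobs I"
  shows "run_time I S j \<le> \<alpha> * min_time I j"
proof -
  note v = valid_instanceD[OF valid assms(2)]
  have mm: "\<alpha> * min_time I j = min (\<alpha> * u_time I j) (\<alpha> * (\<tau> + p_time I j))"
    using \<alpha> \<tau>(2)[OF assms(2)] by (simp add: min_time_def min_mult_distrib_left)
  have ge: "1 * u_time I j \<le> \<alpha> * u_time I j" "1 * (\<tau> + p_time I j) \<le> \<alpha> * (\<tau> + p_time I j)"
    using \<alpha> v \<tau> by (intro mult_right_mono; simp)+
  show ?thesis
  proof (cases "tested \<alpha> I j")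
    case True
    then have u: "\<alpha> * \<tau> \<le> u_time I j" using \<tau>(2)[OF assms(2)] by (simp add: tested_def)
    \<comment> \<open>By the golden ratio identity the left side is \<open>\<tau>\<close>: a
      needless test costs at most \<open>(\<alpha> - 1) * u_time I j\<close>.\<close>
    have "(\<alpha> - 1) * (\<alpha> * \<tau>) \<le> (\<alpha> - 1) * u_time I j" using \<alpha> u by (intro mult_left_mono) auto
    moreover have "(\<alpha> - 1) * (\<alpha> * \<tau>) = (\<alpha>\<^sup>2 - \<alpha>) * \<tau>" by (simp add: power2_eq_square algebra_simps)
    ultimately have "\<tau> + u_time I j \<le> \<alpha> * u_time I j" using assms(1) by (simp add: algebra_simps)
    then show ?thesis unfolding run_time_eq[OF assms(2)] mm using True v ge by simp
  next
    case False
    then have "u_time I j < \<alpha> * \<tau>" using \<tau>(2)[OF assms(2)] by (simp add: tested_def)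
    moreover have "\<alpha> * \<tau> \<le> \<alpha> * (\<tau> + p_time I j)" using \<alpha> v by simp
    ultimately show ?thesis unfolding run_time_eq[OF assms(2)] mm using False ge by simp
  qed
qed

lemma sum_delay_le:
  assumes \<alpha>2: "\<alpha>\<^sup>2 = \<alpha> + 1" "1.618 \<le> \<alpha>" and \<beta>: "2.316 \<le> \<beta>" "\<beta> \<le> 2.3166"
  defines "n \<equiv> jobs I" and "\<rho> \<equiv> min_time I"
  shows "2 * (\<Sum>j<n. \<Sum>k<n. if k = j then 0 else delay k j) + 2 * (\<Sum>j<n. run_time I S j)
    \<le> (2 * \<alpha> - 1) * ((\<Sum>j<n. \<Sum>k<n. min (\<rho> j) (\<rho> k)) + (\<Sum>j<n. \<rho> j))"
proof -
  define L where "L j = (if tested \<alpha> I j then level \<beta> (p_time I j / \<tau>) else 0)" for j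
  define D where "D k j = (if k = j then 0 else delay k j)" for k j
  define s where "s = 2 * \<alpha> - 1"
  have \<rho>0: "0 \<le> \<rho> j" if "j < n" for j
    using that valid_instanceD[OF valid, of j] by (simp add: \<rho>_def min_time_def n_def)
  have pair: "D k j + D j k + (if k = j then 2 * run_time I S j else 0)
      \<le> s * (min (\<rho> j) (\<rho> k) + (if k = j then \<rho> j else 0)) - \<tau> * (L j * L k)"
    if jk: "j < n" "k < n" for j k
  proof (cases "k = j")
    case True
    have "run_time I S j \<le> \<alpha> * \<rho> j"
      unfolding \<rho>_def by (rule run_time_le[OF \<alpha>2(1)]) (use jk in \<open>simp add: n_def\<close>)
    \<comment> \<open>On the diagonal \<open>2 * s * \<rho> j - 2 * \<alpha> * \<rho> j = 2 *
      (\<alpha> - 1) * \<rho> j\<close> is available. For a tested job this is at least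
      \<open>1.236 * \<tau>\<close>, while a squared level is at most one.\<close>
    moreover have "\<tau> * (L j * L j) \<le> 2 * ((\<alpha> - 1) * \<rho> j)"
    proof (cases "tested \<alpha> I j")
      case t: True
      have "1 * \<tau> \<le> \<alpha> * \<tau>" using \<alpha> \<tau> by (intro mult_right_mono) auto
      then have "\<tau> \<le> \<rho> j"
        using t jk valid_instanceD[OF valid, of j] \<tau>(2)[of j]
        unfolding tested_def \<rho>_def min_time_def n_def by auto
      then have "309 / 500 * \<tau> \<le> (\<alpha> - 1) * \<rho> j" using \<alpha>2 \<tau> by (intro mult_mono) auto
      moreover have "L j * L j \<le> 1" by (simp add: L_def level_def)
      then have "\<tau> * (L j * L j) \<le> \<tau> * 1" using \<tau> by (intro mult_left_mono) auto
      ultimately show ?thesis using \<tau>(1) by linarith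
    next
      case False
      then show ?thesis using \<rho>0[OF jk(1)] \<alpha> by (simp add: L_def)
    qed
    ultimately show ?thesis using True by (simp add: D_def s_def algebra_simps)
  next
    case False
    have un: "delay k j + delay j k \<le> s * min (\<rho> j) (\<rho> k)" if "\<not> tested \<alpha> I j" "j < n" "k < n" "j \<noteq> k" for j k
    proof -
      have "delay k j + delay j k \<le> \<alpha> * min (\<rho> j) (\<rho> k)"
        unfolding \<rho>_def by (rule delay_pair_untested) (use that in \<open>auto simp: n_def\<close>)
      also have "\<dots> \<le> s * min (\<rho> j) (\<rho> k)"
        using \<alpha> \<rho>0 that by (intro mult_right_mono) (auto simp: s_def)
      finally show ?thesis .
    qed
    consider "\<not> tested \<alpha> I j" | "\<not> tested \<alpha> I k" | "tested \<alpha> I j" "tested \<alpha> I k" by blast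
    then show ?thesis
    proof cases
      case 1
      then show ?thesis using un[OF 1 jk] False by (simp add: D_def L_def)
    next
      case 2
      then show ?thesis using un[OF 2 jk(2,1)] False by (simp add: D_def L_def min.commute)
    next
      case 3
      have jk': "j < jobs I" "k < jobs I" using jk by (simp_all add: n_def)
      note v = valid_instanceD[OF valid jk'(1)] valid_instanceD[OF valid jk'(2)]
      have "delay k j + delay j k \<le> s * min (min (u_time I j) (\<tau> + p_time I j)) (min (u_time I k) (\<tau> + p_time I k))
          - \<tau> * (level \<beta> (p_time I j / \<tau>) * level \<beta> (p_time I k / \<tau>))"
        unfolding s_def
        by (rule tested_pair_bound[OF \<alpha>2 \<beta> \<tau>(1) _ _ _ _ _ _ delay_pair_tested[OF jk' _ 3]])
          (use v 3 \<tau>(2) jk' False in \<open>simp_all add: tested_def\<close>)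
      then show ?thesis using False 3 \<tau>(2) jk' by (simp add: D_def L_def \<rho>_def min_time_def)
    qed
  qed
  have "2 * (\<Sum>j<n. \<Sum>k<n. D k j) + 2 * (\<Sum>j<n. run_time I S j)
      = (\<Sum>j<n. \<Sum>k<n. D k j) + (\<Sum>j<n. \<Sum>k<n. D j k) + (\<Sum>j<n. 2 * run_time I S j)"
    unfolding sum.swap[of "\<lambda>j k. D j k"] by (simp add: sum_distrib_left)
  also have "\<dots> = (\<Sum>j<n. \<Sum>k<n. D k j + D j k + (if k = j then 2 * run_time I S j else 0))"
    by (simp add: sum.distrib)
  also have "\<dots> \<le> (\<Sum>j<n. \<Sum>k<n. s * (min (\<rho> j) (\<rho> k) + (if k = j then \<rho> j else 0)) - \<tau> * (L j * L k))"
    by (intro sum_mono pair) auto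
  also have "\<dots> = s * ((\<Sum>j<n. \<Sum>k<n. min (\<rho> j) (\<rho> k)) + (\<Sum>j<n. \<rho> j)) - \<tau> * (\<Sum>j<n. L j)\<^sup>2"
    by (simp add: sum_subtractf sum.distrib sum_distrib_left[symmetric] power2_eq_square sum_product)
  also have "\<dots> \<le> s * ((\<Sum>j<n. \<Sum>k<n. min (\<rho> j) (\<rho> k)) + (\<Sum>j<n. \<rho> j))"
    using \<tau>(1) by simp
  finally show ?thesis unfolding D_def s_def .
qed

lemma cost_le:
  assumes \<alpha>2: "\<alpha>\<^sup>2 = \<alpha> + 1" "1.618 \<le> \<alpha>" and \<beta>: "2.316 \<le> \<beta>" "\<beta> \<le> 2.3166"
    and S': "feasible m I S'"
  shows "cost I S \<le> ((2 * \<alpha> - 1) * (1 / 2 + 1 / (2 * real m)) + \<alpha> * (1 - 1 / real m)) * cost I S'"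
proof -
  define n where "n = jobs I"
  define \<rho> where "\<rho> = min_time I"
  define R where "R = (\<Sum>j<n. \<rho> j)"
  define K where "K = (\<Sum>j<n. \<Sum>k<n. min (\<rho> j) (\<rho> k))"
  define W where "W = (\<Sum>j<n. \<Sum>k<n. if k = j then 0 else delay k j)"
  define own where "own = (\<Sum>j<n. run_time I S j)"
  define V where "V = cost I S'"
  define e where "e = 1 / real m"
  have e: "0 < e" "e \<le> 1" using m by (auto simp: e_def)
  have V: "R \<le> V" "R / 2 + e * K / 2 \<le> V"
    using sum_min_time_le_cost[OF S' valid] min_kernel_le_cost[OF S' valid m]
    unfolding V_def R_def K_def n_def \<rho>_def e_def by simp_all
  have own: "own \<le> \<alpha> * R"
    unfolding own_def R_def sum_distrib_left \<rho>_def n_def by (intro sum_mono run_time_le \<alpha>2) simp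
  have "cost I S \<le> (\<Sum>j<n. (\<Sum>k<n. if k = j then 0 else delay k j) / real m + run_time I S j)"
    unfolding cost_def n_def by (intro sum_mono completion_time_le) simp
  \<comment> \<open>Only the share \<open>e\<close> of the running times joins the pairwise bound;
    the rest is bounded job by job.\<close>
  also have "\<dots> = e * (W + own) + (1 - e) * own"
    unfolding W_def own_def by (simp add: e_def sum.distrib sum_divide_distrib[symmetric] add_divide_distrib algebra_simps)
  also have "\<dots> \<le> e * ((2 * \<alpha> - 1) * (K + R) / 2) + (1 - e) * (\<alpha> * R)"
  proof (intro add_mono mult_left_mono)
    show "W + own \<le> (2 * \<alpha> - 1) * (K + R) / 2"
      using sum_delay_le[OF \<alpha>2 \<beta>] unfolding W_def own_def K_def R_def n_def \<rho>_def by simp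
  qed (use own e in auto)
  \<comment> \<open>Writing \<open>\<alpha> = (2 * \<alpha> - 1) / 2 + 1 / 2\<close> isolates
    exactly the two expressions for which lower bounds on the comparison cost are known.\<close>
  also have "\<dots> = (2 * \<alpha> - 1) * (R / 2 + e * K / 2) + (1 - e) / 2 * R"
    by (simp add: field_simps)
  also have "\<dots> \<le> (2 * \<alpha> - 1) * V + (1 - e) / 2 * V"
    using V e \<alpha> by (intro add_mono mult_left_mono) auto
  also have "\<dots> = ((2 * \<alpha> - 1) * (1 / 2 + e / 2) + \<alpha> * (1 - e)) * V"
    by (simp add: field_simps)
  also have "e / 2 = 1 / (2 * real m)" by (simp add: e_def)
  finally show ?thesis unfolding V_def e_def .
qed

end

section \<open>The numerical constants, the competitive ratio and its limit\<close>

theorem corollary22: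
  fixes \<phi> \<beta> :: real
  assumes "\<phi> = (1 + sqrt 5) / 2"
    and "\<beta> = (\<phi> + sqrt (5 * \<phi> + 1)) / 2"
  shows "\<beta> \<le> 2.31652 \<and>
    (\<forall>m\<ge>1. has_competitive_ratio (pcpm \<phi> \<beta>) m uniform_instances
       (sqrt 5 * (1 / 2 + 1 / (2 * real m)) + \<phi> * (1 - 1 / real m))) \<and>
    (\<exists>L. (\<lambda>m. sqrt 5 * (1 / 2 + 1 / (2 * real m)) + \<phi> * (1 - 1 / real m)) \<longlonglongrightarrow> L \<and>
       2.73606 \<le> L \<and> L < 2.73607)"
proof -
  have s5: "2.236067 \<le> sqrt 5" "sqrt 5 \<le> 2.236068"
    by (rule real_le_rsqrt real_le_lsqrt; simp add: power2_eq_square)+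
  have \<phi>: "\<phi>\<^sup>2 = \<phi> + 1" "1.6180335 \<le> \<phi>" "\<phi> \<le> 1.618034" "sqrt 5 = 2 * \<phi> - 1"
    using s5 unfolding assms(1) by (simp_all add: power2_eq_square field_simps)
  have "3.0149 \<le> sqrt (5 * \<phi> + 1)" "sqrt (5 * \<phi> + 1) \<le> 3.015"
    using \<phi>(2,3) by (intro real_le_rsqrt real_le_lsqrt; simp add: power2_eq_square)+
  then have \<beta>: "2.316 \<le> \<beta>" "\<beta> \<le> 2.31652" using \<phi> unfolding assms(2) by simp_all
  have ratio: "has_competitive_ratio (pcpm \<phi> \<beta>) m uniform_instances
       (sqrt 5 * (1 / 2 + 1 / (2 * real m)) + \<phi> * (1 - 1 / real m))" if m: "1 \<le> m" for m
    unfolding has_competitive_ratio_def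
  proof (intro ballI conjI allI impI)
    fix I assume "I \<in> uniform_instances"
    then obtain \<tau> where I: "valid_instance I" "0 < \<tau>" "\<And>j. j < jobs I \<Longrightarrow> t_time I j = \<tau>"
      unfolding uniform_instances_def by auto
    show "\<exists>S. pcpm \<phi> \<beta> m I S" by (rule pcpm_exists[OF I(1)])
    fix S assume "pcpm \<phi> \<beta> m I S"
    then obtain s where s: "(pcpm_step \<beta> I)\<^sup>*\<^sup>* (pcpm_init m \<phi> I) s" "active s = {}" "plan s = S"
      unfolding pcpm_def by blast
    have inv: "run_inv m \<phi> \<beta> I s" by (rule run_inv_reachable[OF s(1) I(1)])
    then obtain B where B: "history m \<beta> I S B" using s(3) unfolding run_inv_def by blast
    note f = pcpm_feasible[OF inv s(2) m, unfolded s(3)]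
    show "feasible m I S" by (rule f(1))
    interpret uniform_run m \<phi> \<beta> \<tau> I S B
      by unfold_locales (use m I f B \<phi> \<beta> in auto)
    define c where "c = sqrt 5 * (1 / 2 + 1 / (2 * real m)) + \<phi> * (1 - 1 / real m)"
    have "0 < sqrt 5 * (1 / 2 + 1 / (2 * real m))" using m by (intro mult_pos_pos add_pos_pos) auto
    moreover have "0 \<le> \<phi> * (1 - 1 / real m)" using m \<phi> by simp
    ultimately have c0: "0 < c" by (simp add: c_def)
    \<comment> \<open>\<open>opt_cost\<close> is an infimum. Dividing by \<open>c > 0\<close> gives
      a lower bound for all feasible costs, so attainment of the minimum does not enter.\<close>
    have "cost I S / c \<le> opt_cost m I" unfolding opt_cost_def
    proof (rule cINF_greatest)
      show "{S. feasible m I S} \<noteq> {}" using f(1) by blast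
      fix S' assume "S' \<in> {S. feasible m I S}"
      then have "cost I S \<le> c * cost I S'"
        using cost_le[of S'] \<phi> \<beta> unfolding c_def by simp
      then show "cost I S / c \<le> cost I S'" using c0 by (simp add: divide_le_eq mult.commute)
    qed
    then show "cost I S \<le> (sqrt 5 * (1 / 2 + 1 / (2 * real m)) + \<phi> * (1 - 1 / real m)) * opt_cost m I"
      using c0 unfolding c_def[symmetric] by (simp add: divide_le_eq mult.commute)
  qed
  have "(\<lambda>m. sqrt 5 * (1 / 2 + (1 / 2) * (1 / real m)) + \<phi> * (1 - 1 / real m))
      \<longlonglongrightarrow> sqrt 5 * (1 / 2 + (1 / 2) * 0) + \<phi> * (1 - 0)"
    by (intro tendsto_intros lim_1_over_n)
  then have "(\<lambda>m. sqrt 5 * (1 / 2 + 1 / (2 * real m)) + \<phi> * (1 - 1 / real m)) \<longlonglongrightarrow> sqrt 5 / 2 + \<phi>"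
    by simp
  moreover have "2.73606 \<le> sqrt 5 / 2 + \<phi>" "sqrt 5 / 2 + \<phi> < 2.73607"
    using s5 \<phi>(2,3) by simp_all
  ultimately show ?thesis using ratio \<beta> by blast
qed

end
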